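(* For $k\ge1$ let $d_k$ be the limit probability (as $n\to\infty$) that a fixed vertex of a uniformly random labelled 2-connected outerplanar graph has degree $k$. Then \[ p(w)=\sum_{k\ge1} d_k w^k=\frac{2(3-2\sqrt2)\,w^2}{\bigl(1-(\sqrt2-1)w\bigr)^2}=\sum_{k\ge2} 2(k-1)(\sqrt2-1)^k w^k, \] and $p(1)=1$, so that the $d_k$ form a probability distribution.
   Context: All graphs are simple and labelled. A graph is outerplanar if it can be embedded in the plane with all vertices incident to the outer face. For each $n$, the random graph is drawn uniformly among 2-connected outerplanar graphs on the vertex set $\{1,\dots,n\}$ (equivalently, $d_k=\lim_{n\to\infty}[x^n]B^\bullet_k(x)/[x^n]B'(x)$, where $B$ is the exponential generating function of labelled 2-connected outerplanar graphs and $B^\bullet_k$ is the exponential generating function of such graphs with an extra unlabelled root vertex of degree $k$). *)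

theory Defs
  imports
    "HOL-Probability.Probability"
    "HOL-Computational_Algebra.Formal_Power_Series"
begin

text \<open>
  A graph is given by its vertex set and a set of unordered pairs of distinct vertices, so that
  two labelled graphs on the same vertex set are equal iff their edge sets are.
\<close>

definition simple_graph :: "'a set \<Rightarrow> 'a set set \<Rightarrow> bool" where
  "simple_graph V E \<longleftrightarrow> finite V \<and> E \<subseteq> {{u, v} |u v. u \<in> V \<and> v \<in> V \<and> u \<noteq> v}"

definition vertex_degree :: "'a set set \<Rightarrow> 'a \<Rightarrow> nat" where
  "vertex_degree E v = card {u. {u, v} \<in> E}"

text \<open>Only edges inside \<open>V\<close> count, so this may be applied to induced subgraphs directly.\<close>

definition connected_graph :: "'a set \<Rightarrow> 'a set set \<Rightarrow> bool" where
  "connected_graph V E \<longleftrightarrow>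
     V \<noteq> {} \<and> (\<forall>u\<in>V. \<forall>v\<in>V. (u, v) \<in> {(x, y). x \<in> V \<and> y \<in> V \<and> {x, y} \<in> E}\<^sup>*)"

text \<open>As usual in the enumeration of blocks, a single edge counts as 2-connected.\<close>

definition two_connected :: "'a set \<Rightarrow> 'a set set \<Rightarrow> bool" where
  "two_connected V E \<longleftrightarrow>
     card V \<ge> 2 \<and> connected_graph V E \<and> (\<forall>x\<in>V. connected_graph (V - {x}) E)"

text \<open>
  Plane drawings: vertices are distinct points, and edges are arcs that join their end points and
  meet vertices and each other only in common end points.
\<close>

definition plane_embedding ::
    "'a set \<Rightarrow> 'a set set \<Rightarrow> ('a \<Rightarrow> complex) \<Rightarrow> ('a set \<Rightarrow> real \<Rightarrow> complex) \<Rightarrow> bool" where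
  "plane_embedding V E pos \<gamma> \<longleftrightarrow>
     inj_on pos V \<and>
     (\<forall>e\<in>E. arc (\<gamma> e) \<and> {pathstart (\<gamma> e), pathfinish (\<gamma> e)} = pos ` e \<and>
            path_image (\<gamma> e) \<inter> pos ` V = pos ` e) \<and>
     (\<forall>e\<in>E. \<forall>f\<in>E. e \<noteq> f \<longrightarrow> path_image (\<gamma> e) \<inter> path_image (\<gamma> f) = pos ` (e \<inter> f))"

definition drawing ::
    "'a set \<Rightarrow> 'a set set \<Rightarrow> ('a \<Rightarrow> complex) \<Rightarrow> ('a set \<Rightarrow> real \<Rightarrow> complex) \<Rightarrow> complex set" where
  "drawing V E pos \<gamma> = pos ` V \<union> (\<Union>e\<in>E. path_image (\<gamma> e))"

text \<open>
  The drawing of a finite graph is compact, so \<^const>\<open>outside\<close> of it is the unique unbounded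
  face; a vertex is incident to a face iff it lies on its frontier.
\<close>

definition outerplanar :: "'a set \<Rightarrow> 'a set set \<Rightarrow> bool" where
  "outerplanar V E \<longleftrightarrow>
     (\<exists>pos \<gamma>. plane_embedding V E pos \<gamma> \<and> pos ` V \<subseteq> frontier (outside (drawing V E pos \<gamma>)))"

definition two_connected_outerplanar_graphs :: "nat \<Rightarrow> nat set set set" where
  "two_connected_outerplanar_graphs n =
     {E. simple_graph {1..n} E \<and> two_connected {1..n} E \<and> outerplanar {1..n} E}"

text \<open>
  \<^const>\<open>pmf_of_set\<close> is unspecified on the empty set, which concerns only \<open>n < 2\<close> here.
\<close>

definition degree_prob :: "nat \<Rightarrow> nat \<Rightarrow> nat \<Rightarrow> real" where
  "degree_prob n v k =
     measure_pmf.prob (pmf_of_set (two_connected_outerplanar_graphs n)) {E. vertex_degree E v = k}"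

text \<open>
  The vertex labelled 1 serves as the fixed vertex. That the limit exists, and is the same for
  every other vertex, has to be proved.
\<close>

definition limit_degree_prob :: "nat \<Rightarrow> real" where
  "limit_degree_prob k = lim (\<lambda>n. degree_prob n 1 k)"

definition limit_degree_pgf :: "complex \<Rightarrow> complex" where
  "limit_degree_pgf w = (\<Sum>\<^sub>\<infinity>k\<in>{1..}. complex_of_real (limit_degree_prob k) * w ^ k)"

definition limit_degree_fps :: "real fps" where
  "limit_degree_fps = Abs_fps (\<lambda>k. if k \<ge> 1 then limit_degree_prob k else 0)"

end

(*
  Of the three arcs of a theta curve in the plane, one runs inside the Jordan curve formed by the
  other two. In an outerplanar drawing no vertex lies inside a closed curve of the drawing, so three
  internally disjoint paths with common ends cannot all have inner vertices. Hence a longest cycle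
  of a 2-connected outerplanar graph passes through all vertices, and its chords do not cross.
  Conversely, a polygon with noncrossing chords is drawn by placing its vertices on a parabola. The
  Hamilton cycle is determined by the graph: its edges are those whose end points do not separate
  the graph. So the degree of a vertex is distributed as in a uniform dissection of an n-gon.

  Let S be the generating function of the large Schroeder numbers, S = x + x S + S^2. Cutting along
  the k chords at a fixed vertex of an n-gon leaves k + 1 independent pieces, so that the dissections
  with k such chords are counted by the coefficient of x^(n-2) in S^(k+1), while there are s_(n-1) / 2
  dissections in total. Now s_n / s_(n+1) tends to (sqrt 2 - 1)^2, and S^2 = (1 - x) S - x becomes a
  linear recurrence with double root sqrt 2 - 1 for the limits of [x^n] S^j / s_(n+1).
*)

theory Submission
  imports Defs
begin

subsection \<open>Theta curves\<close>

text \<open>Edges are drawn as arbitrary arcs, so the geometry has to be done with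
  \<open>inside\<close> and \<open>outside\<close>. It yields two combinatorial facts about vertex
  lists, \<open>no_theta\<close> and \<open>no_crossing_chords\<close>; afterwards no drawing is
  analysed except the explicit one on the parabola. The number of Hamilton cycles is never computed:
  every Hamilton cycle carries the same number of graphs with a given degree at \<open>v\<close>, so
  it cancels in the quotient. Writing each cycle with \<open>v\<close> in last position makes the
  count independent of \<open>v\<close>. The ratio limit is elementary. S is algebraic, so a square
  root of a polynomial satisfies a linear differential equation that turns into a recurrence; for r
  = s_(n+1) / s_n it reads r' = 6 - 1/r + O(1/n), which contracts towards 3 + 2 sqrt 2. With l =
  sqrt 2 - 1 the limits L_j of [x^n] S^j / s_(n+1) satisfy L_(j+2) = (1 - l^2) L_(j+1) - l^2 L_j.
  Since l^2 = 1 - 2 l, the characteristic polynomial is (t - l)^2, and L_0 = 0, L_1 = l^2 give L_j =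
  j l^(j+1). Degree k means k - 2 chords, hence j = k - 1; the total s_(n-1) / 2 contributes the
  factor 2 in 2 (k - 1) l^k.\<close>

lemma Jordan_two_arcs:
  fixes c1 c2 :: "real \<Rightarrow> complex"
  assumes "arc c1" "arc c2" "pathstart c1 = a" "pathfinish c1 = b" "pathstart c2 = a" "pathfinish c2 = b"
    and "path_image c1 \<inter> path_image c2 = {a, b}"
  shows "inside (path_image c1 \<union> path_image c2) \<noteq> {}"
    and "connected (inside (path_image c1 \<union> path_image c2))"
    and "frontier (inside (path_image c1 \<union> path_image c2)) = path_image c1 \<union> path_image c2"
proof -
  let ?c = "c1 +++ reversepath c2"
  have "simple_path ?c"
    using assms by (intro simple_path_join_loop) (auto simp: arc_reversepath)
  moreover have "pathfinish ?c = pathstart ?c"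
    using assms by simp
  moreover have "path_image ?c = path_image c1 \<union> path_image c2"
    using assms by (simp add: path_image_join)
  ultimately show "inside (path_image c1 \<union> path_image c2) \<noteq> {}"
    "connected (inside (path_image c1 \<union> path_image c2))"
    "frontier (inside (path_image c1 \<union> path_image c2)) = path_image c1 \<union> path_image c2"
    using Jordan_inside_outside[of ?c] by auto
qed

text \<open>A connected set that meets both the inside and the outside of \<open>S\<close> has to
  cross \<open>S\<close>.\<close>

lemma connected_subset_inside_or_outside:
  assumes "connected T" "T \<inter> S = {}"
  shows "T \<subseteq> inside S \<or> T \<subseteq> outside S"
proof -
  have "inside S \<inter> T = {} \<or> outside S \<inter> T = {}"
    using inside_outside_intersect_connected[OF assms(1), of S] assms(2) by blast
  then show ?thesis
    using assms(2) union_with_inside[of S] by blast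
qed

text \<open>
  If no arc were inside the other two, a point inside the curve \<open>A \<union> B\<close> would be outside both
  \<open>A \<union> C\<close> and \<open>B \<union> C\<close>, hence by Janiszewski's theorem not separated from infinity by the union.
\<close>

lemma theta_curve_one_arc_inside:
  fixes c1 c2 c3 :: "real \<Rightarrow> complex"
  assumes arcs: "arc c1" "arc c2" "arc c3"
    and ends: "pathstart c1 = a" "pathfinish c1 = b" "pathstart c2 = a" "pathfinish c2 = b"
      "pathstart c3 = a" "pathfinish c3 = b"
    and int: "path_image c1 \<inter> path_image c2 = {a, b}" "path_image c1 \<inter> path_image c3 = {a, b}"
      "path_image c2 \<inter> path_image c3 = {a, b}"
  shows "path_image c1 - {a, b} \<subseteq> inside (path_image c2 \<union> path_image c3) \<or>
         path_image c2 - {a, b} \<subseteq> inside (path_image c1 \<union> path_image c3) \<or>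
         path_image c3 - {a, b} \<subseteq> inside (path_image c1 \<union> path_image c2)"
proof -
  define A where "A = path_image c1"
  define B where "B = path_image c2"
  define C where "C = path_image c3"
  note defs = A_def B_def C_def
  have simple: "simple_path c1" "simple_path c2" "simple_path c3"
    using arcs by (auto intro: arc_imp_simple_path)
  have cp: "compact A" "compact B" "compact C"
    using arcs by (auto simp: defs intro: compact_arc_image)
  have con: "connected (A - {a, b})" "connected (B - {a, b})" "connected (C - {a, b})"
    using connected_simple_path_endless[OF simple(1)] connected_simple_path_endless[OF simple(2)]
      connected_simple_path_endless[OF simple(3)] ends by (auto simp: defs)
  have ne: "A - {a, b} \<noteq> {}" "B - {a, b} \<noteq> {}" "C - {a, b} \<noteq> {}"
    using nonempty_simple_path_endless[OF simple(1)] nonempty_simple_path_endless[OF simple(2)]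
      nonempty_simple_path_endless[OF simple(3)] ends by (auto simp: defs)
  have int': "A \<inter> B = {a, b}" "A \<inter> C = {a, b}" "B \<inter> C = {a, b}"
    using int by (auto simp: defs)
  \<comment> \<open>The region inside \<open>X\<close> and \<open>Y\<close> avoids \<open>Z\<close>,
    so it lies on one side of the curve formed by \<open>Z\<close> and \<open>Y\<close>. Its
    frontier contains an inner point of \<open>X\<close>, which is outside that curve; this decides
    the side.\<close>
  have step: "inside (X \<union> Y) \<subseteq> outside (Z \<union> Y)"
    if "connected (inside (X \<union> Y))" "frontier (inside (X \<union> Y)) = X \<union> Y"
      and neX: "X - {a, b} \<noteq> {}" and "X - {a, b} \<subseteq> outside (Z \<union> Y)" "Z - {a, b} \<subseteq> outside (X \<union> Y)"
      "a \<in> Y" "b \<in> Y" "compact Z" "compact Y" for X Y Z :: "complex set"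
  proof -
    have "inside (X \<union> Y) \<inter> (Z \<union> Y) = {}"
      using that inside_Int_outside[of "X \<union> Y"] inside_no_overlap[of "X \<union> Y"] by blast
    from connected_subset_inside_or_outside[OF that(1) this]
    consider "inside (X \<union> Y) \<subseteq> inside (Z \<union> Y)" | "inside (X \<union> Y) \<subseteq> outside (Z \<union> Y)" by blast
    then show ?thesis
    proof cases
      case 1
      obtain y where y: "y \<in> X - {a, b}" using neX by blast
      have op: "open (outside (Z \<union> Y))"
        using that by (intro open_outside compact_imp_closed compact_Un)
      have "y \<in> closure (inside (X \<union> Y))"
        using y that(2) unfolding frontier_def by blast
      moreover have "y \<in> outside (Z \<union> Y)" using y that by blast
      ultimately have "outside (Z \<union> Y) \<inter> inside (X \<union> Y) \<noteq> {}"
        using open_Int_closure_eq_empty[OF op] by blast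
      then show ?thesis using 1 inside_Int_outside[of "Z \<union> Y"] by blast
    qed
  qed
  show ?thesis
  proof (rule ccontr)
    assume "\<not> ?thesis"
    then have not: "\<not> A - {a, b} \<subseteq> inside (B \<union> C)" "\<not> B - {a, b} \<subseteq> inside (A \<union> C)"
      "\<not> C - {a, b} \<subseteq> inside (A \<union> B)" by (auto simp: defs)
    have dis: "(A - {a, b}) \<inter> (B \<union> C) = {}" "(B - {a, b}) \<inter> (A \<union> C) = {}"
      "(C - {a, b}) \<inter> (A \<union> B) = {}"
      using int' by blast+
    have out: "A - {a, b} \<subseteq> outside (B \<union> C)" "B - {a, b} \<subseteq> outside (A \<union> C)"
      "C - {a, b} \<subseteq> outside (A \<union> B)"
      using connected_subset_inside_or_outside[OF con(1) dis(1)]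
        connected_subset_inside_or_outside[OF con(2) dis(2)]
        connected_subset_inside_or_outside[OF con(3) dis(3)] not by auto
    note J = Jordan_two_arcs[OF arcs(1,2) ends(1-4) int(1), folded defs]
    obtain p where p: "p \<in> inside (A \<union> B)" using J(1) by blast
    have "bounded (A \<union> B \<union> C)" using cp by (simp add: compact_imp_bounded)
    then obtain q where q: "q \<in> outside (A \<union> B \<union> C)"
      using unbounded_outside by fastforce
    have ab: "a \<in> A" "b \<in> A" "a \<in> B" "b \<in> B"
      using int' by blast+
    have "inside (B \<union> A) \<subseteq> outside (C \<union> A)"
      by (rule step) (use J(2,3) ne(2) out(2,3) ab cp in \<open>simp_all add: Un_commute\<close>)
    then have pC: "p \<in> outside (A \<union> C)"
      using p by (auto simp: Un_commute)
    have "inside (A \<union> B) \<subseteq> outside (C \<union> B)"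
      by (rule step) (use J(2,3) ne(1) out(1,3) ab cp in \<open>simp_all add: Un_commute\<close>)
    then have pB: "p \<in> outside (B \<union> C)"
      using p by (auto simp: Un_commute)
    have cc: "connected_component (- S) p q"
      if "bounded S" "p \<in> outside S" "q \<in> outside S" for S :: "complex set"
      unfolding connected_component_def
      using connected_outside[OF that(1)] that(2,3) union_with_inside[of S]
      by (intro exI[of _ "outside S"]) auto
    have q': "q \<in> outside (A \<union> C)" "q \<in> outside (B \<union> C)" "q \<in> outside (A \<union> B)"
      by (rule subsetD[OF outside_mono q], blast)+
    have cc': "connected_component (- (A \<union> C)) p q" "connected_component (- (B \<union> C)) p q"
      by (rule cc; use cp pB pC q' in \<open>simp add: compact_imp_bounded\<close>)+
    \<comment> \<open>Janiszewski's theorem asks for a connected intersection; here the intersection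
      is the third arc.\<close>
    have "(A \<union> C) \<inter> (B \<union> C) = C" using int' by blast
    then have "connected ((A \<union> C) \<inter> (B \<union> C))"
      using connected_arc_image[OF arcs(3)] by (simp only: C_def)
    from Janiszewski[OF compact_Un[OF cp(1,3)] compact_imp_closed[OF compact_Un[OF cp(2,3)]] this cc']
    have "connected_component (- ((A \<union> C) \<union> (B \<union> C))) p q" .
    then have "connected_component (- (A \<union> B)) p q"
      by (rule connected_component_of_subset) blast
    then have "p \<in> outside (A \<union> B)"
      using outside_same_component q'(3) by (metis connected_component_sym)
    then show False using p inside_Int_outside by blast
  qed
qed

text \<open>By continuity the end points are limits of the open arc. So a chord whose interior stays
  in a region cannot end at a point exterior to that region.\<close>

lemma arc_image_subset_closure_endless:
  fixes g :: "real \<Rightarrow> 'a::t2_space"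
  assumes "arc g"
  shows "path_image g \<subseteq> closure (path_image g - {pathstart g, pathfinish g})"
proof -
  have "continuous_on (closure {0<..<1::real}) g"
    using arc_imp_path[OF assms] by (simp add: path_def)
  then have "g ` closure {0<..<1::real} \<subseteq> closure (g ` {0<..<1})"
    by (rule image_closure_subset) (auto simp: closure_subset)
  then show ?thesis
    using simple_path_endless[OF arc_imp_simple_path[OF assms]] by (simp add: path_image_def)
qed

subsection \<open>Paths in outerplane drawings\<close>

fun path_edges :: "'a list \<Rightarrow> 'a set set" where
  "path_edges (x # y # zs) = insert {x, y} (path_edges (y # zs))"
| "path_edges _ = {}"

text \<open>No vertex set is mentioned: from two vertices on, the edges themselves force the
  vertices into it, while lists with at most one vertex are paths over any edge set.\<close>

definition graph_path :: "'a set set \<Rightarrow> 'a list \<Rightarrow> bool" where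
  "graph_path E xs \<longleftrightarrow> distinct xs \<and> path_edges xs \<subseteq> E"

lemma path_edges_append:
  "xs \<noteq> [] \<Longrightarrow> ys \<noteq> [] \<Longrightarrow>
    path_edges (xs @ ys) = insert {last xs, hd ys} (path_edges xs \<union> path_edges ys)"
proof (induction xs rule: path_edges.induct)
  case (1 x y zs)
  then show ?case by auto
next
  case ("2_2" x)
  then show ?case by (cases ys) auto
qed simp

lemma path_edges_rev: "path_edges (rev xs) = path_edges xs"
proof (induction xs rule: path_edges.induct)
  case (1 x y zs)
  have "path_edges (rev (y # zs) @ [x]) = insert {y, x} (path_edges (rev (y # zs)))"
    using path_edges_append[of "rev (y # zs)" "[x]"] by simp
  then show ?case using 1 by (simp add: insert_commute)
qed simp_all

lemma path_edges_subset_set: "e \<in> path_edges xs \<Longrightarrow> e \<subseteq> set xs"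
  by (induction xs rule: path_edges.induct) auto

lemma Union_path_edges: "2 \<le> length xs \<Longrightarrow> \<Union>(path_edges xs) = set xs"
proof (induction xs rule: path_edges.induct)
  case (1 x y zs)
  then show ?case by (cases zs) auto
qed simp_all

lemma card_path_edge: "distinct xs \<Longrightarrow> e \<in> path_edges xs \<Longrightarrow> card e = 2"
  by (induction xs rule: path_edges.induct) auto

lemma finite_path_edges [simp]: "finite (path_edges xs)"
  by (induction xs rule: path_edges.induct) auto

lemma ends_not_path_edge:
  assumes "distinct xs" "3 \<le> length xs"
  shows "{hd xs, last xs} \<notin> path_edges xs"
proof -
  obtain x y z zs where xs: "xs = x # y # z # zs"
    using assms(2) by (auto simp: numeral_3_eq_3 Suc_le_length_iff)
  have "{x, last xs} \<noteq> {x, y}"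
    using assms(1) xs by (auto simp: doubleton_eq_iff)
  moreover have "{x, last xs} \<notin> path_edges (y # z # zs)"
    using path_edges_subset_set[of _ "y # z # zs"] assms(1) xs by auto
  ultimately show ?thesis using xs by auto
qed

text \<open>A common edge could only be \<open>{a, b}\<close>, but these are the ends of
  \<open>ys\<close>, which has a vertex in between. The length condition is on \<open>ys\<close>
  alone, so that \<open>xs\<close> may be the single chord from \<open>a\<close> to
  \<open>b\<close>.\<close>

lemma disjoint_path_edges:
  assumes "distinct xs" "distinct ys" "set xs \<inter> set ys = {a, b}"
    and "3 \<le> length ys" "hd ys = a" "last ys = b"
  shows "path_edges xs \<inter> path_edges ys = {}"
proof (rule ccontr)
  assume "path_edges xs \<inter> path_edges ys \<noteq> {}"
  then obtain e where e: "e \<in> path_edges xs" "e \<in> path_edges ys" by blast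
  then have "e \<subseteq> {a, b}" using path_edges_subset_set assms(3) by blast
  moreover have "card e = 2" using card_path_edge e assms by blast
  ultimately have "e = {a, b}"
    by (auto simp: card_2_iff)
  then show False using ends_not_path_edge[OF assms(2,4)] e assms by simp
qed

locale outerplanar_drawing =
  fixes V :: "'a set" and E :: "'a set set" and pos :: "'a \<Rightarrow> complex"
    and \<gamma> :: "'a set \<Rightarrow> real \<Rightarrow> complex"
  assumes simple: "simple_graph V E"
    and emb: "plane_embedding V E pos \<gamma>"
    and outer: "pos ` V \<subseteq> frontier (outside (drawing V E pos \<gamma>))"
begin

definition curve :: "'a list \<Rightarrow> complex set" where
  "curve xs = (\<Union>e\<in>path_edges xs. path_image (\<gamma> e))"

lemma inj_pos: "inj_on pos V"
  and edge_arc: "e \<in> E \<Longrightarrow> arc (\<gamma> e)"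
  and edge_ends: "e \<in> E \<Longrightarrow> {pathstart (\<gamma> e), pathfinish (\<gamma> e)} = pos ` e"
  and edge_vertices: "e \<in> E \<Longrightarrow> path_image (\<gamma> e) \<inter> pos ` V = pos ` e"
  and edge_Int: "e \<in> E \<Longrightarrow> f \<in> E \<Longrightarrow> e \<noteq> f \<Longrightarrow>
    path_image (\<gamma> e) \<inter> path_image (\<gamma> f) = pos ` (e \<inter> f)"
  using emb unfolding plane_embedding_def by blast+

lemma edge_subset: "e \<in> E \<Longrightarrow> e \<subseteq> V"
  using simple unfolding simple_graph_def by blast

lemma path_subset:
  assumes "path_edges xs \<subseteq> E" "2 \<le> length xs"
  shows "set xs \<subseteq> V"
proof -
  have "\<Union>(path_edges xs) \<subseteq> V" using assms(1) edge_subset by blast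
  then show ?thesis using Union_path_edges[OF assms(2)] by simp
qed

lemma edge_arc_oriented:
  assumes "{x, y} \<in> E"
  obtains g where "arc g" "pathstart g = pos x" "pathfinish g = pos y"
    "path_image g = path_image (\<gamma> {x, y})"
proof -
  have "{pathstart (\<gamma> {x, y}), pathfinish (\<gamma> {x, y})} = {pos x, pos y}"
    using edge_ends[OF assms] by simp
  then consider "pathstart (\<gamma> {x, y}) = pos x" "pathfinish (\<gamma> {x, y}) = pos y"
    | "pathstart (\<gamma> {x, y}) = pos y" "pathfinish (\<gamma> {x, y}) = pos x"
    by (auto simp: doubleton_eq_iff)
  then show ?thesis
  proof cases
    case 1
    then show ?thesis using that edge_arc[OF assms] by blast
  next
    case 2
    then show ?thesis
      using that[of "reversepath (\<gamma> {x, y})"] edge_arc[OF assms] by (simp add: arc_reversepath)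
  qed
qed

lemma curve_vertex:
  assumes "path_edges xs \<subseteq> E" "2 \<le> length xs" "v \<in> V"
  shows "pos v \<in> curve xs \<longleftrightarrow> v \<in> set xs"
proof -
  have "pos v \<in> path_image (\<gamma> e) \<longleftrightarrow> v \<in> e" if "e \<in> path_edges xs" for e
  proof -
    have "e \<in> E" using that assms by blast
    then have "pos v \<in> path_image (\<gamma> e) \<longleftrightarrow> pos v \<in> pos ` e"
      using edge_vertices[of e] assms(3) by blast
    then show ?thesis
      using inj_on_image_mem_iff[OF inj_pos assms(3) edge_subset[OF \<open>e \<in> E\<close>]] by blast
  qed
  then show ?thesis
    using Union_path_edges[OF assms(2)] unfolding curve_def by blast
qed

lemma curve_Int_subset:
  assumes "path_edges xs \<subseteq> E" "path_edges ys \<subseteq> E" "path_edges xs \<inter> path_edges ys = {}"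
  shows "curve xs \<inter> curve ys \<subseteq> pos ` (set xs \<inter> set ys)"
proof
  fix z assume "z \<in> curve xs \<inter> curve ys"
  then obtain e f where ef: "e \<in> path_edges xs" "f \<in> path_edges ys"
      "z \<in> path_image (\<gamma> e) \<inter> path_image (\<gamma> f)"
    unfolding curve_def by blast
  moreover have "e \<noteq> f" using ef assms by blast
  ultimately have "z \<in> pos ` (e \<inter> f)"
    using edge_Int assms by blast
  then show "z \<in> pos ` (set xs \<inter> set ys)"
    using path_edges_subset_set ef by blast
qed

lemma curve_arc:
  assumes "graph_path E xs" "2 \<le> length xs"
  shows "\<exists>g. arc g \<and> pathstart g = pos (hd xs) \<and> pathfinish g = pos (last xs) \<and>
    path_image g = curve xs"
  using assms
proof (induction xs rule: path_edges.induct)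
  case (1 x y zs)
  have E: "{x, y} \<in> E" "graph_path E (y # zs)"
    using 1 unfolding graph_path_def by auto
  obtain g where g: "arc g" "pathstart g = pos x" "pathfinish g = pos y"
    "path_image g = path_image (\<gamma> {x, y})"
    using edge_arc_oriented[OF E(1)] .
  show ?case
  proof (cases zs)
    case Nil
    then show ?thesis using g by (auto simp: curve_def)
  next
    case (Cons z zs')
    then obtain h where h: "arc h" "pathstart h = pos y" "pathfinish h = pos (last (y # zs))"
      "path_image h = curve (y # zs)"
      using 1 E(2) by auto
    \<comment> \<open>The arc of the first edge meets the rest of the path only at their joint
      \<open>y\<close>, which is what joining two arcs to an arc requires.\<close>
    have "path_image g \<inter> path_image h = curve [x, y] \<inter> curve (y # zs)"
      using g h by (simp add: curve_def)
    also have "\<dots> \<subseteq> pos ` (set [x, y] \<inter> set (y # zs))"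
    proof (rule curve_Int_subset)
      show "path_edges [x, y] \<inter> path_edges (y # zs) = {}"
        using 1(2) path_edges_subset_set[of "{x, y}" "y # zs"] by (auto simp: graph_path_def)
    qed (use 1(2) in \<open>auto simp: graph_path_def\<close>)
    also have "\<dots> \<subseteq> {pathstart h}"
      using 1(2) h by (auto simp: graph_path_def)
    finally have "arc (g +++ h)"
      using g h by (intro arc_join) auto
    then show ?thesis
      using g h Cons by (intro exI[of _ "g +++ h"]) (auto simp: path_image_join curve_def)
  qed
qed auto

lemma closed_curve:
  assumes "path_edges xs \<subseteq> E"
  shows "closed (curve xs)"
  unfolding curve_def using assms
  by (intro closed_UN) (auto intro!: closed_arc_image edge_arc)

lemma curve_subset_drawing: "path_edges xs \<subseteq> E \<Longrightarrow> curve xs \<subseteq> drawing V E pos \<gamma>"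
  unfolding curve_def drawing_def by blast

text \<open>The set \<open>inside J\<close> is open and misses the outer face, because
  \<open>outside\<close> is antitone; hence it contains no limit of the outer face. This is where
  the assumption \<open>outer\<close> enters.\<close>

lemma vertex_not_inside:
  assumes "v \<in> V" "closed J" "J \<subseteq> drawing V E pos \<gamma>"
  shows "pos v \<notin> inside J"
proof
  assume "pos v \<in> inside J"
  moreover have "pos v \<in> closure (outside (drawing V E pos \<gamma>))"
    using outer assms(1) unfolding frontier_def by blast
  ultimately have "inside J \<inter> outside (drawing V E pos \<gamma>) \<noteq> {}"
    using open_Int_closure_eq_empty[OF open_inside[OF assms(2)]] by blast
  then show False
    using outside_mono[OF assms(3)] inside_Int_outside[of J] by blast
qed

text \<open>One of the three paths runs inside the other two, and it is neither \<open>ys\<close>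
  nor \<open>zs\<close>, since these have inner vertices. The path \<open>xs\<close> may consist of
  one edge; in this form the lemma places chords inside the cycle.\<close>

lemma theta_path_inside:
  assumes paths: "graph_path E xs" "graph_path E ys" "graph_path E zs"
    and hd: "hd xs = a" "hd ys = a" "hd zs = a" and last: "last xs = b" "last ys = b" "last zs = b"
    and len: "2 \<le> length xs" "3 \<le> length ys" "3 \<le> length zs"
    and int: "set xs \<inter> set ys = {a, b}" "set xs \<inter> set zs = {a, b}" "set ys \<inter> set zs = {a, b}"
  shows "curve xs - {pos a, pos b} \<subseteq> inside (curve ys \<union> curve zs)"
proof -
  have E: "path_edges xs \<subseteq> E" "path_edges ys \<subseteq> E" "path_edges zs \<subseteq> E"
    and dis: "distinct xs" "distinct ys" "distinct zs"
    using paths unfolding graph_path_def by auto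
  have V: "set xs \<subseteq> V" "set ys \<subseteq> V" "set zs \<subseteq> V"
    using path_subset[OF E(1)] path_subset[OF E(2)] path_subset[OF E(3)] len by auto
  have inner: "\<exists>v\<in>V. v \<in> set ps \<and> v \<notin> {a, b}" if "distinct ps" "3 \<le> length ps" "set ps \<subseteq> V" for ps
  proof -
    have "card {a, b} < card (set ps)"
      using that by (simp add: distinct_card card_insert_if)
    then have "\<not> set ps \<subseteq> {a, b}" by (metis card_mono finite.emptyI finite_insert not_le)
    then show ?thesis using that by blast
  qed
  have inner_pos: "pos v \<in> curve ps - {pos a, pos b}"
    if "v \<in> V" "v \<in> set ps" "v \<notin> {a, b}" "path_edges ps \<subseteq> E" "3 \<le> length ps" for v ps
  proof -
    have "pos v \<in> curve ps" using that curve_vertex[of ps v] by auto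
    moreover have "a \<in> V" "b \<in> V" using V int by blast+
    then have "pos v \<noteq> pos a" "pos v \<noteq> pos b"
      using inj_onD[OF inj_pos] that by blast+
    ultimately show ?thesis by simp
  qed
  obtain g1 where g1: "arc g1" "pathstart g1 = pos a" "pathfinish g1 = pos b" "path_image g1 = curve xs"
    using curve_arc[OF paths(1)] len hd last by auto
  obtain g2 where g2: "arc g2" "pathstart g2 = pos a" "pathfinish g2 = pos b" "path_image g2 = curve ys"
    using curve_arc[OF paths(2)] len hd last by auto
  obtain g3 where g3: "arc g3" "pathstart g3 = pos a" "pathfinish g3 = pos b" "path_image g3 = curve zs"
    using curve_arc[OF paths(3)] len hd last by auto
  have de: "path_edges xs \<inter> path_edges ys = {}" "path_edges xs \<inter> path_edges zs = {}"
    "path_edges ys \<inter> path_edges zs = {}"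
    using disjoint_path_edges dis int len hd last by metis+
  have ends: "{pos a, pos b} \<subseteq> path_image g1" "{pos a, pos b} \<subseteq> path_image g2"
    "{pos a, pos b} \<subseteq> path_image g3"
    using g1 g2 g3 by (metis insert_subset pathstart_in_path_image pathfinish_in_path_image empty_subsetI)+
  have ci: "path_image g1 \<inter> path_image g2 = {pos a, pos b}"
    "path_image g1 \<inter> path_image g3 = {pos a, pos b}" "path_image g2 \<inter> path_image g3 = {pos a, pos b}"
    using curve_Int_subset[OF E(1,2) de(1)] curve_Int_subset[OF E(1,3) de(2)]
      curve_Int_subset[OF E(2,3) de(3)] ends g1(4) g2(4) g3(4) int by auto
  have notin: "\<not> curve ps - {pos a, pos b} \<subseteq> inside (curve qs \<union> curve rs)"
    if hyp: "path_edges ps \<subseteq> E" "path_edges qs \<subseteq> E" "path_edges rs \<subseteq> E" "distinct ps" "3 \<le> length ps" "set ps \<subseteq> V"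
    for ps qs rs
  proof -
    obtain v where "v \<in> V" "v \<in> set ps" "v \<notin> {a, b}" using inner[OF hyp(4-6)] by blast
    moreover from this have "pos v \<notin> inside (curve qs \<union> curve rs)"
      using hyp by (intro vertex_not_inside closed_Un closed_curve Un_least curve_subset_drawing)
    ultimately show ?thesis using inner_pos hyp by blast
  qed
  show ?thesis
    using theta_curve_one_arc_inside[OF g1(1) g2(1) g3(1) g1(2,3) g2(2,3) g3(2,3) ci]
      notin[of ys xs zs] notin[of zs xs ys] E V dis len
    by (simp add: g1(4) g2(4) g3(4))
qed

text \<open>With an inner vertex on \<open>xs\<close> as well, that vertex would lie inside the
  closed curve of the other two paths.\<close>

lemma no_theta:
  assumes "graph_path E xs" "graph_path E ys" "graph_path E zs"
    and "hd xs = a" "hd ys = a" "hd zs = a" "last xs = b" "last ys = b" "last zs = b"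
    and len: "3 \<le> length xs" "3 \<le> length ys" "3 \<le> length zs"
    and "set xs \<inter> set ys = {a, b}" "set xs \<inter> set zs = {a, b}" "set ys \<inter> set zs = {a, b}"
  shows False
proof -
  have sub: "curve xs - {pos a, pos b} \<subseteq> inside (curve ys \<union> curve zs)"
    by (rule theta_path_inside) (use assms in auto)
  have E: "path_edges xs \<subseteq> E" "path_edges ys \<subseteq> E" "path_edges zs \<subseteq> E" and "distinct xs"
    using assms unfolding graph_path_def by auto
  have V: "set xs \<subseteq> V"
    using path_subset[OF E(1)] len by simp
  have "card {a, b} < card (set xs)"
    using len \<open>distinct xs\<close> by (simp add: distinct_card card_insert_if)
  then have "\<not> set xs \<subseteq> {a, b}" by (metis card_mono finite.emptyI finite_insert not_le)
  then obtain v where v: "v \<in> set xs" "v \<notin> {a, b}" by blast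
  have "a \<in> V" "b \<in> V" using V assms by auto
  then have "pos v \<in> curve xs - {pos a, pos b}"
    using v V curve_vertex[of xs v] E len inj_pos by (auto simp: inj_on_def)
  moreover have "pos v \<notin> inside (curve ys \<union> curve zs)"
    using E v V by (intro vertex_not_inside closed_Un closed_curve Un_least curve_subset_drawing) auto
  ultimately show False using sub by blast
qed

text \<open>The chord \<open>ab\<close> splits the inside of the cycle into two regions. The chord
  \<open>cd\<close> runs inside the cycle without meeting \<open>ab\<close>, so it stays in one
  region, although one of its ends is exterior to that region. The cycle is given by its
  decompositions at both pairs of ends.\<close>

lemma no_crossing_chords:
  assumes paths: "graph_path E xs" "graph_path E ys" "graph_path E xs'" "graph_path E ys'"
    and ab: "hd xs = a" "hd ys = a" "last xs = b" "last ys = b" "{a, b} \<in> E"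
    and cd: "hd xs' = c" "hd ys' = c" "last xs' = d" "last ys' = d" "{c, d} \<in> E"
    and len: "3 \<le> length xs" "3 \<le> length ys" "3 \<le> length xs'" "3 \<le> length ys'"
    and int: "set xs \<inter> set ys = {a, b}" "set xs' \<inter> set ys' = {c, d}"
    and cyc: "path_edges xs \<union> path_edges ys = path_edges xs' \<union> path_edges ys'"
    and cross: "c \<in> set xs" "c \<notin> {a, b}" "d \<in> set ys" "d \<notin> {a, b}"
  shows False
proof -
  have E: "path_edges xs \<subseteq> E" "path_edges ys \<subseteq> E"
    and dis: "distinct xs" "distinct ys"
    using paths unfolding graph_path_def by auto
  have V: "a \<in> V" "b \<in> V" "c \<in> V" "d \<in> V" using ab cd edge_subset by blast+
  have neq: "a \<noteq> b" "c \<noteq> d" "{a, b} \<noteq> {c, d}"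
  proof -
    have "card {u, v} = 2" if "hd ps = u" "last ps = v" "distinct ps" "3 \<le> length ps" for u v and ps :: "'a list"
    proof -
      have "u \<noteq> v" using that
        by (cases ps) (auto split: if_splits dest!: last_in_set)
      then show ?thesis by simp
    qed
    from this[of xs a b] this[of xs' c d] have "card {a, b} = 2" "card {c, d} = 2"
      using ab cd len paths unfolding graph_path_def by auto
    then show "a \<noteq> b" "c \<noteq> d" "{a, b} \<noteq> {c, d}" using cross by auto
  qed
  have gp: "graph_path E [a, b]" "graph_path E [c, d]"
    using ab cd neq unfolding graph_path_def by auto
  have sub: "set [a, b] \<inter> set xs = {a, b}" "set [a, b] \<inter> set ys = {a, b}"
     "set [c, d] \<inter> set xs' = {c, d}" "set [c, d] \<inter> set ys' = {c, d}"
    using int by auto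
  \<comment> \<open>Both decompositions trace the same closed curve, so both chords lie in the same
    inside.\<close>
  have eq: "curve xs \<union> curve ys = curve xs' \<union> curve ys'"
    using cyc unfolding curve_def by (metis UN_Un)
  have k: "curve [a, b] - {pos a, pos b} \<subseteq> inside (curve xs \<union> curve ys)"
    by (rule theta_path_inside[OF gp(1) paths(1,2)]) (use ab len int sub in auto)
  have l: "curve [c, d] - {pos c, pos d} \<subseteq> inside (curve xs \<union> curve ys)"
    unfolding eq by (rule theta_path_inside[OF gp(2) paths(3,4)]) (use cd len int sub in auto)
  obtain g1 where g1: "arc g1" "pathstart g1 = pos a" "pathfinish g1 = pos b" "path_image g1 = curve xs"
    using curve_arc[OF paths(1)] len ab by auto
  obtain g2 where g2: "arc g2" "pathstart g2 = pos a" "pathfinish g2 = pos b" "path_image g2 = curve ys"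
    using curve_arc[OF paths(2)] len ab by auto
  obtain g where g: "arc g" "pathstart g = pos a" "pathfinish g = pos b" "path_image g = curve [a, b]"
    using curve_arc[OF gp(1)] by auto
  obtain h where h: "arc h" "pathstart h = pos c" "pathfinish h = pos d" "path_image h = curve [c, d]"
    using curve_arc[OF gp(2)] by auto
  have de: "path_edges xs \<inter> path_edges ys = {}" "path_edges xs \<inter> path_edges [a, b] = {}"
     "path_edges ys \<inter> path_edges [a, b] = {}"
    using disjoint_path_edges[of xs ys a b] ends_not_path_edge[of xs] ends_not_path_edge[of ys]
      dis int len ab by auto
  have ends: "{pos a, pos b} \<subseteq> path_image g1" "{pos a, pos b} \<subseteq> path_image g2"
    "{pos a, pos b} \<subseteq> path_image g"
    using g1 g2 g by (metis insert_subset pathstart_in_path_image pathfinish_in_path_image empty_subsetI)+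
  have "path_edges [a, b] \<subseteq> E" using ab by simp
  note Ek = this
  have ci: "path_image g1 \<inter> path_image g2 = {pos a, pos b}"
    "path_image g1 \<inter> path_image g = {pos a, pos b}" "path_image g2 \<inter> path_image g = {pos a, pos b}"
    using curve_Int_subset[OF E de(1)] curve_Int_subset[OF E(1) Ek de(2)]
      curve_Int_subset[OF E(2) Ek de(3)] ends g1(4) g2(4) g(4) int by auto
  have "path_image g - {pos a, pos b} \<noteq> {}"
    using nonempty_simple_path_endless[OF arc_imp_simple_path[OF g(1)]] g by simp
  then have ne: "path_image g \<inter> inside (path_image g1 \<union> path_image g2) \<noteq> {}"
    using k g(4) g1(4) g2(4) by auto
  have "pos a \<noteq> pos b" using inj_pos V neq by (auto simp: inj_on_def)
  \<comment> \<open>The chord \<open>ab\<close> cuts the inside of the cycle into the region along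
    \<open>xs\<close> and the region along \<open>ys\<close>.\<close>
  from split_inside_simple_closed_curve[OF arc_imp_simple_path[OF g1(1)] g1(2,3)
      arc_imp_simple_path[OF g2(1)] g2(2,3) arc_imp_simple_path[OF g(1)] g(2,3) this ci ne]
  have split: "inside (curve xs \<union> curve [a, b]) \<union> inside (curve ys \<union> curve [a, b]) \<union>
      (curve [a, b] - {pos a, pos b}) = inside (curve xs \<union> curve ys)"
    using g1(4) g2(4) g(4) by metis
  define L where "L = curve [c, d] - {pos c, pos d}"
  have con: "connected L"
    using connected_simple_path_endless[OF arc_imp_simple_path[OF h(1)]] h by (simp add: L_def)
  have Lne: "L \<noteq> {}"
    using nonempty_simple_path_endless[OF arc_imp_simple_path[OF h(1)]] h by (simp add: L_def)
  have "path_edges [a, b] \<inter> path_edges [c, d] = {}" using neq by simp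
  from curve_Int_subset[OF _ _ this] have "curve [a, b] \<inter> L = {}"
    using ab cd cross by (auto simp: L_def)
  moreover have "(curve xs \<union> curve ys) \<inter> L = {}"
    using l inside_no_overlap[of "curve xs \<union> curve ys"] unfolding L_def by blast
  ultimately have disj: "L \<inter> (curve xs \<union> curve [a, b]) = {}" "L \<inter> (curve ys \<union> curve [a, b]) = {}"
    by blast+
  \<comment> \<open>Here \<open>ps\<close> is the side whose region contains the open chord
    \<open>L\<close>, and \<open>v\<close> is the end of \<open>cd\<close> on the other side. This
    end is exterior to the region and yet a limit of \<open>L\<close>.\<close>
  have contra: False
    if L: "L \<subseteq> inside (curve ps \<union> curve [a, b])" and P: "path_edges ps \<subseteq> E" "2 \<le> length ps" and v: "v \<in> {c, d}" "v \<notin> set ps"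
      and sub: "inside (curve ps \<union> curve [a, b]) \<subseteq> inside (curve xs \<union> curve ys)" "pos v \<in> curve xs \<union> curve ys" for ps v
  proof -
    let ?O = "outside (curve ps \<union> curve [a, b])"
    have vV: "v \<in> V" "v \<notin> {a, b}" using v V cross by auto
    have "pos v \<notin> inside (curve ps \<union> curve [a, b])"
      using sub inside_no_overlap[of "curve xs \<union> curve ys"] by blast
    moreover have "pos v \<notin> curve ps" "pos v \<notin> curve [a, b]"
      using curve_vertex[OF P vV(1)] curve_vertex[OF Ek _ vV(1)] v(2) vV(2) by auto
    ultimately have "pos v \<in> ?O"
      using union_with_inside[of "curve ps \<union> curve [a, b]"] by blast
    moreover have "pos v \<in> path_image h"
      using v h by (metis insertE pathfinish_in_path_image pathstart_in_path_image singletonD)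
    then have "pos v \<in> closure L"
      using arc_image_subset_closure_endless[OF h(1)] h by (auto simp: L_def)
    moreover have "open ?O"
      using P Ek by (intro open_outside closed_Un closed_curve)
    ultimately have "?O \<inter> L \<noteq> {}"
      using open_Int_closure_eq_empty by blast
    then show False using L inside_Int_outside[of "curve ps \<union> curve [a, b]"] by blast
  qed
  have pc: "pos c \<in> curve xs \<union> curve ys" "pos d \<in> curve xs \<union> curve ys" "c \<notin> set ys" "d \<notin> set xs"
    using curve_vertex[OF E(1) _ V(3)] curve_vertex[OF E(2) _ V(4)] cross len int by auto
  have "L \<subseteq> inside (curve xs \<union> curve ys)" using l by (simp add: L_def)
  then obtain "L \<subseteq> inside (curve xs \<union> curve [a, b]) \<or> L \<subseteq> inside (curve ys \<union> curve [a, b])"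
    using connected_subset_inside_or_outside[OF con disj(1)]
      connected_subset_inside_or_outside[OF con disj(2)] split Lne disj
      inside_Int_outside[of "curve xs \<union> curve [a, b]"]
      inside_Int_outside[of "curve ys \<union> curve [a, b]"] by blast
  then show False
    using contra[of xs d] contra[of ys c] split pc E len by auto
qed

end

subsection \<open>Hamilton cycles\<close>

definition cycle_edges :: "'a list \<Rightarrow> 'a set set" where
  "cycle_edges xs = insert {last xs, hd xs} (path_edges xs)"

definition graph_cycle :: "'a set set \<Rightarrow> 'a list \<Rightarrow> bool" where
  "graph_cycle E xs \<longleftrightarrow> distinct xs \<and> 3 \<le> length xs \<and> cycle_edges xs \<subseteq> E"

lemma cycle_edges_rotate: "cycle_edges (ys @ xs) = cycle_edges (xs @ ys)"
  by (cases "xs = []"; cases "ys = []") (auto simp: cycle_edges_def path_edges_append)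

lemma graph_cycle_rotate: "graph_cycle E (xs @ ys) \<Longrightarrow> graph_cycle E (ys @ xs)"
  unfolding graph_cycle_def using cycle_edges_rotate[of xs ys] by auto

text \<open>After \<open>b\<close> the cycle runs back to \<open>a\<close>; reversing that stretch
  makes both paths lead from \<open>a\<close> to \<open>b\<close>, as the facts on theta curves
  require.\<close>

lemma cycle_edges_two_paths:
  "cycle_edges (a # q @ b # s) = path_edges (a # q @ [b]) \<union> path_edges (a # rev s @ [b])"
proof -
  have "path_edges (a # rev s @ [b]) = path_edges (b # s @ [a])"
    using path_edges_rev[of "b # s @ [a]"] by simp
  moreover have "path_edges (a # q @ b # s) = path_edges (a # q @ [b]) \<union> path_edges (b # s)"
    using path_edges_append[of "a # q" "b # s"] path_edges_append[of "a # q" "[b]"] by simp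
  moreover have "path_edges (b # s @ [a]) = insert {last (b # s), a} (path_edges (b # s))"
    using path_edges_append[of "b # s" "[a]"] by simp
  ultimately show ?thesis by (auto simp: cycle_edges_def)
qed

lemma path_edges_append_superset:
  "path_edges xs \<subseteq> path_edges (xs @ ys)" "path_edges ys \<subseteq> path_edges (xs @ ys)"
  by (cases "xs = []"; cases "ys = []"; auto simp: path_edges_append)+

section \<open>Paths, ears and cycles in 2-connected graphs\<close>

lemma graph_path_appendD:
  assumes "graph_path E (xs @ ys)"
  shows "graph_path E xs" "graph_path E ys"
  using assms path_edges_append_superset[of xs ys] path_edges_append_superset[of ys xs]
  unfolding graph_path_def by auto

text \<open>Walks are shortened to paths on the fly: if the vertex to be prepended already occurs,
  the path is cut off before that occurrence.\<close>

lemma connected_graph_path: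
  assumes "connected_graph W E" "u \<in> W" "v \<in> W"
  obtains xs where "graph_path E xs" "xs \<noteq> []" "hd xs = u" "last xs = v" "set xs \<subseteq> W"
proof -
  let ?R = "{(x, y). x \<in> W \<and> y \<in> W \<and> {x, y} \<in> E}"
  have "(u, v) \<in> ?R\<^sup>*" using assms unfolding connected_graph_def by blast
  then have "\<exists>xs. graph_path E xs \<and> xs \<noteq> [] \<and> hd xs = u \<and> last xs = v \<and> set xs \<subseteq> W"
  proof (induction rule: converse_rtrancl_induct)
    case base
    then show ?case using assms by (intro exI[of _ "[v]"]) (auto simp: graph_path_def)
  next
    case (step u y)
    then obtain xs where xs: "graph_path E xs" "xs \<noteq> []" "hd xs = y" "last xs = v" "set xs \<subseteq> W"
      by blast
    show ?case
    proof (cases "u \<in> set xs")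
      case True
      then obtain ys zs where yz: "xs = ys @ u # zs" by (meson split_list)
      then show ?thesis using xs graph_path_appendD(2)[of E ys "u # zs"]
        by (intro exI[of _ "u # zs"]) auto
    next
      case False
      have "path_edges (u # xs) \<subseteq> E"
        using step xs path_edges_append[of "[u]" xs] by (auto simp: graph_path_def)
      then show ?thesis using xs False step(1)
        by (intro exI[of _ "u # xs"]) (auto simp: graph_path_def)
    qed
  qed
  then show ?thesis using that by blast
qed

lemma first_vertex_in:
  assumes "graph_path E xs" "xs \<noteq> []" "hd xs \<notin> C" "last xs \<in> C"
  obtains ys b where "graph_path E (ys @ [b])" "ys \<noteq> []" "hd ys = hd xs" "b \<in> C"
    "set ys \<inter> C = {}" "set (ys @ [b]) \<subseteq> set xs"
proof -
  have "\<exists>x\<in>set xs. x \<in> C" using assms by (meson last_in_set)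
  from split_list_first_prop[OF this]
  obtain ys b zs where *: "xs = ys @ b # zs" "b \<in> C" "\<forall>y\<in>set ys. y \<notin> C" by blast
  then have "graph_path E ((ys @ [b]) @ zs)" using assms by simp
  then have "graph_path E (ys @ [b])" by (rule graph_path_appendD)
  moreover have "ys \<noteq> []" using * assms by (cases ys) auto
  ultimately show ?thesis using that[of ys b] * by auto
qed

text \<open>A path from a vertex off the cycle first meets the cycle at some \<open>a\<close>,
  coming from a vertex \<open>w'\<close> off the cycle. Removing \<open>a\<close> leaves a connected
  graph, so from \<open>w'\<close> the cycle can be reached again at some \<open>b\<close> other
  than \<open>a\<close>.\<close>

lemma two_connected_ear:
  assumes tc: "two_connected V E" and cyc: "graph_cycle E xs" and sub: "set xs \<subset> V"
  obtains ps a b where "graph_path E ps" "3 \<le> length ps" "hd ps = a" "last ps = b" "a \<noteq> b"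
    "set ps \<inter> set xs = {a, b}" "set ps \<subseteq> V"
proof -
  obtain w where w: "w \<in> V" "w \<notin> set xs" using sub by blast
  have xs: "xs \<noteq> []" "distinct xs" "3 \<le> length xs" using cyc by (auto simp: graph_cycle_def)
  then have "hd xs \<in> V" using sub hd_in_set by blast
  then obtain ps where ps: "graph_path E ps" "ps \<noteq> []" "hd ps = w" "last ps = hd xs" "set ps \<subseteq> V"
    using connected_graph_path[of V E w "hd xs"] tc w unfolding two_connected_def by blast
  obtain ys a where ya: "graph_path E (ys @ [a])" "ys \<noteq> []" "a \<in> set xs" "set ys \<inter> set xs = {}"
      "set (ys @ [a]) \<subseteq> V"
    using first_vertex_in[of E ps "set xs"] ps w xs by (metis hd_in_set order_trans)
  \<comment> \<open>The ear is rebuilt from the edge between \<open>a\<close> and \<open>w'\<close>;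
    the path that led to \<open>w'\<close> is discarded, as it might meet the second one.\<close>
  define w' where "w' = last ys"
  have w': "w' \<in> V" "w' \<notin> set xs" "{a, w'} \<in> E"
  proof -
    have "w' \<in> set ys" using ya(2) by (simp add: w'_def)
    then show "w' \<in> V" "w' \<notin> set xs" using ya(4,5) by auto
    have "{w', a} \<in> path_edges (ys @ [a])"
      using path_edges_append[of ys "[a]"] ya(2) by (simp add: w'_def)
    then show "{a, w'} \<in> E" using ya(1) by (auto simp: graph_path_def insert_commute)
  qed
  have "a \<noteq> w'" using w' ya by blast
  have "card (set xs) > card {a}" using xs by (simp add: distinct_card)
  then have "\<not> set xs \<subseteq> {a}" by (metis card_mono finite.emptyI finite_insert not_le)
  then obtain b0 where b0: "b0 \<in> set xs" "b0 \<noteq> a" by blast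
  have "connected_graph (V - {a}) E" using tc ya unfolding two_connected_def by auto
  then obtain qs where qs: "graph_path E qs" "qs \<noteq> []" "hd qs = w'" "last qs = b0" "set qs \<subseteq> V - {a}"
    using connected_graph_path[of "V - {a}" E w' b0] w' b0 \<open>a \<noteq> w'\<close> sub by blast
  obtain zs b where zb: "graph_path E (zs @ [b])" "zs \<noteq> []" "hd zs = w'" "b \<in> set xs"
      "set zs \<inter> set xs = {}" "set (zs @ [b]) \<subseteq> V - {a}"
    using first_vertex_in[of E qs "set xs"] qs w' b0 by (metis order_trans)
  show ?thesis
  proof (rule that[of "a # zs @ [b]" a b])
    show "graph_path E (a # zs @ [b])"
      using path_edges_append[of "[a]" "zs @ [b]"] zb w' by (auto simp: graph_path_def)
    show "3 \<le> length (a # zs @ [b])" using zb(2) by (cases zs) auto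
  qed (use zb ya in auto)
qed

text \<open>Take an edge \<open>ab\<close>, a further neighbour \<open>c\<close> of \<open>b\<close>
  (present because the graph without \<open>a\<close> is connected) and a path from \<open>c\<close>
  to \<open>a\<close> avoiding \<open>b\<close>; the vertex \<open>b\<close> closes it to a
  cycle.\<close>

lemma two_connected_cycle:
  assumes tc: "two_connected V E" and "card V \<ge> 3"
  obtains xs where "graph_cycle E xs" "set xs \<subseteq> V"
proof -
  have another: "\<exists>w\<in>V. w \<notin> {x, y}" for x y
  proof -
    have "card {x, y} < card V" using assms(2) by (simp add: card_insert_if)
    then have "\<not> V \<subseteq> {x, y}" by (metis card_mono finite.emptyI finite_insert not_le)
    then show ?thesis by blast
  qed
  have nbr: "\<exists>y\<in>W. y \<noteq> x \<and> {x, y} \<in> E"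
    if W: "connected_graph W E" and "x \<in> W" "z \<in> W" "z \<noteq> x" for W x z
  proof -
    obtain ps where ps: "graph_path E ps" "ps \<noteq> []" "hd ps = x" "last ps = z" "set ps \<subseteq> W"
      using connected_graph_path[OF W \<open>x \<in> W\<close> \<open>z \<in> W\<close>] .
    then obtain y qs where "ps = x # y # qs"
      using \<open>z \<noteq> x\<close> by (metis last_ConsL list.collapse)
    then show ?thesis using ps by (auto simp: graph_path_def)
  qed
  have con: "connected_graph V E" "\<And>x. x \<in> V \<Longrightarrow> connected_graph (V - {x}) E"
    using tc unfolding two_connected_def by auto
  obtain a where a: "a \<in> V" using another by blast
  obtain z where "z \<in> V" "z \<noteq> a" using another[of a a] by blast
  then obtain b where b: "b \<in> V" "b \<noteq> a" "{a, b} \<in> E" using nbr[OF con(1) a] by blast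
  obtain w where "w \<in> V" "w \<notin> {a, b}" using another by blast
  then obtain c where c: "c \<in> V" "c \<noteq> a" "c \<noteq> b" "{b, c} \<in> E"
    using nbr[OF con(2)[OF a], of b w] b by blast
  obtain ps where ps: "graph_path E ps" "ps \<noteq> []" "hd ps = c" "last ps = a" "set ps \<subseteq> V - {b}"
    using connected_graph_path[OF con(2)[OF b(1)], of c a] a b c by blast
  have "graph_cycle E (b # ps)"
    unfolding graph_cycle_def
  proof (intro conjI)
    show "distinct (b # ps)" using ps by (auto simp: graph_path_def)
    show "3 \<le> length (b # ps)"
    proof (cases ps)
      case (Cons x qs)
      then show ?thesis using ps c by (cases qs) auto
    qed (use ps in simp)
    show "cycle_edges (b # ps) \<subseteq> E"
      using path_edges_append[of "[b]" ps] ps b c by (auto simp: cycle_edges_def graph_path_def)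
  qed
  moreover have "set (b # ps) \<subseteq> V" using ps b by auto
  ultimately show ?thesis using that by blast
qed

section \<open>Longest cycles and their chords in outerplane drawings\<close>

context outerplanar_drawing
begin

lemma Hamiltonian:
  assumes tc: "two_connected V E" and V3: "card V \<ge> 3"
  obtains xs where "graph_cycle E xs" "set xs = V"
proof -
  have fin: "finite V" using simple by (simp add: simple_graph_def)
  let ?P = "\<lambda>xs. graph_cycle E xs \<and> set xs \<subseteq> V"
  obtain xs0 where "?P xs0" by (rule two_connected_cycle[OF tc V3]) simp
  moreover have "\<forall>xs. ?P xs \<longrightarrow> length xs < Suc (card V)"
  proof (intro allI impI)
    fix xs assume "?P xs"
    then show "length xs < Suc (card V)"
      using card_mono[OF fin, of "set xs"] distinct_card[of xs] by (simp add: graph_cycle_def)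
  qed
  ultimately obtain xs where xs: "?P xs" and max: "\<And>ys. ?P ys \<Longrightarrow> length ys \<le> length xs"
    using ex_has_greatest_nat[of ?P xs0 length "Suc (card V)"] by blast
  have "set xs = V"
  proof (rule ccontr)
    assume "set xs \<noteq> V"
    then have "set xs \<subset> V" using xs by blast
    then obtain ps a b where ps: "graph_path E ps" "3 \<le> length ps" "hd ps = a" "last ps = b" "a \<noteq> b"
      "set ps \<inter> set xs = {a, b}" "set ps \<subseteq> V"
      using two_connected_ear[OF tc] xs by metis
    have "ps \<noteq> []" using ps by auto
    have "a \<in> set xs" "b \<in> set xs" using ps by blast+
    then obtain pre suf where pre: "xs = pre @ a # suf" by (meson split_list)
    define ys where "ys = suf @ pre"
    have ys: "graph_cycle E (a # ys)" "set (a # ys) = set xs" "length (a # ys) = length xs"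
      using xs graph_cycle_rotate[of E pre "a # suf"] by (auto simp: pre ys_def)
    have "b \<in> set ys" using \<open>b \<in> set xs\<close> ys(2) ps(5) by (metis set_ConsD)
    then obtain ys1 ys2 where yy: "ys = ys1 @ b # ys2" by (meson split_list)
    have E: "path_edges (a # ys1 @ [b]) \<subseteq> E" "path_edges (a # rev ys2 @ [b]) \<subseteq> E"
      and dis: "distinct (a # ys1 @ b # ys2)" and len: "length ys1 + length ys2 \<ge> 1"
      using ys(1) cycle_edges_two_paths[of a ys1 b ys2] by (auto simp: yy graph_cycle_def)
    have Eps: "path_edges ps \<subseteq> E" "distinct ps" using ps by (auto simp: graph_path_def)
    have inter: "set ps \<inter> set ys1 = {}" "set ps \<inter> set ys2 = {}"
    proof -
      have "set ys1 \<subseteq> set xs - {a, b}" "set ys2 \<subseteq> set xs - {a, b}"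
        unfolding ys(2)[symmetric] yy using dis by auto
      then show "set ps \<inter> set ys1 = {}" "set ps \<inter> set ys2 = {}" using ps(6) by blast+
    qed
    \<comment> \<open>The length condition says that \<open>q\<close> lists all cycle vertices
      except \<open>a\<close> and \<open>b\<close>, which are therefore adjacent on the cycle.
      Replacing their edge by the ear adds at least one vertex.\<close>
    have longer: False
      if "q \<noteq> []" "path_edges (a # q @ [b]) \<subseteq> E" "distinct (a # q @ [b])" "set ps \<inter> set q = {}"
        "set q \<subseteq> set xs" "length q + 2 = length xs" for q
    proof -
      have "graph_cycle E (ps @ rev q)"
        unfolding graph_cycle_def
      proof (intro conjI)
        have "path_edges (rev q) \<subseteq> E" "{last q, b} \<in> E" "{a, hd q} \<in> E"
          using that(1,2) path_edges_append[of "[a]" "q @ [b]"] path_edges_append[of q "[b]"]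
          by (auto simp: path_edges_rev)
        then show "cycle_edges (ps @ rev q) \<subseteq> E"
          using that(1) Eps ps \<open>ps \<noteq> []\<close>
          by (auto simp: cycle_edges_def path_edges_append hd_rev last_rev insert_commute)
      qed (use that ps Eps in auto)
      moreover have "set (ps @ rev q) \<subseteq> V" using that ps xs by auto
      ultimately have "length (ps @ rev q) \<le> length xs" using max by blast
      then show False using that ps by simp
    qed
    have sub: "set ys1 \<subseteq> set xs" "set ys2 \<subseteq> set xs" using ys(2) yy by auto
    \<comment> \<open>Either the ends of the ear are neighbours on the cycle, which contradicts
      maximality, or ear and cycle form a theta curve with inner vertices on all three
      paths.\<close>
    consider "ys1 = []" | "ys2 = []" | "ys1 \<noteq> []" "ys2 \<noteq> []" by blast
    then show False
    proof cases
      case 1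
      show False
        by (rule longer[of "rev ys2"]) (use 1 E dis inter sub len ys(3) yy in auto)
    next
      case 2
      show False
        by (rule longer[of ys1]) (use 2 E dis inter sub len ys(3) yy in auto)
    next
      case 3
      show False
      proof (rule no_theta)
        show "graph_path E ps" "graph_path E (a # ys1 @ [b])" "graph_path E (a # rev ys2 @ [b])"
          using ps E dis by (auto simp: graph_path_def)
        show "set ps \<inter> set (a # ys1 @ [b]) = {a, b}" "set ps \<inter> set (a # rev ys2 @ [b]) = {a, b}"
          using inter ps by auto
        show "set (a # ys1 @ [b]) \<inter> set (a # rev ys2 @ [b]) = {a, b}" using dis by auto
        show "3 \<le> length (a # ys1 @ [b])" "3 \<le> length (a # rev ys2 @ [b])"
          using 3 by (cases ys1; cases ys2; simp)+
      qed (use ps in auto)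
    qed
  qed
  then show ?thesis using that xs by blast
qed

text \<open>The cycle is read once from \<open>a\<close>, splitting at \<open>b\<close>, and once
  from \<open>c\<close>, splitting at \<open>d\<close>. The two readings have the same edges and
  supply the two decompositions needed for crossing chords.\<close>

lemma cycle_chords_not_crossing_aux:
  assumes cyc: "graph_cycle E (a # q1 @ c # q2 @ b # q3 @ d # r)"
    and ch: "{a, b} \<in> E" "{c, d} \<in> E"
  shows False
proof -
  have cyc': "cycle_edges (c # (q2 @ b # q3) @ d # (r @ a # q1)) =
      cycle_edges (a # (q1 @ c # q2) @ b # (q3 @ d # r))"
    using cycle_edges_rotate[of "c # q2 @ b # q3 @ d # r" "a # q1"] by simp
  note two = cycle_edges_two_paths[of a "q1 @ c # q2" b "q3 @ d # r"]
    cycle_edges_two_paths[of c "q2 @ b # q3" d "r @ a # q1"]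
  have E: "cycle_edges (a # (q1 @ c # q2) @ b # (q3 @ d # r)) \<subseteq> E"
    and dis: "distinct (a # q1 @ c # q2 @ b # q3 @ d # r)"
    using cyc by (auto simp: graph_cycle_def)
  show False
  proof (rule no_crossing_chords[of "a # (q1 @ c # q2) @ [b]" "a # rev (q3 @ d # r) @ [b]"
        "c # (q2 @ b # q3) @ [d]" "c # rev (r @ a # q1) @ [d]" a b c d])
    show "graph_path E (a # (q1 @ c # q2) @ [b])" "graph_path E (a # rev (q3 @ d # r) @ [b])"
      using E two(1) dis unfolding graph_path_def by auto
    show "graph_path E (c # (q2 @ b # q3) @ [d])" "graph_path E (c # rev (r @ a # q1) @ [d])"
      using E two(2) cyc' dis unfolding graph_path_def by auto
    show "path_edges (a # (q1 @ c # q2) @ [b]) \<union> path_edges (a # rev (q3 @ d # r) @ [b]) =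
      path_edges (c # (q2 @ b # q3) @ [d]) \<union> path_edges (c # rev (r @ a # q1) @ [d])"
      using two cyc' by metis
  qed (use ch dis in auto)
qed

lemma cycle_chords_not_crossing:
  assumes cyc: "graph_cycle E xs" and lt: "i < k" "k < j" "j < l" "l < length xs"
    and ch: "{xs ! i, xs ! j} \<in> E" "{xs ! k, xs ! l} \<in> E"
  shows False
proof -
  \<comment> \<open>Applied four times, this exposes the four positions in order; the part before
    position \<open>i\<close> is then rotated to the end of the cycle.\<close>
  have split: "drop m xs = take (p - m) (drop m xs) @ xs ! p # drop (Suc p) xs"
    if "m \<le> p" "p < length xs" for m p
  proof -
    have "p - m < length (drop m xs)" using that by simp
    from id_take_nth_drop[OF this] show ?thesis using that by simp
  qed
  have "xs = take i xs @ xs ! i # take (k - Suc i) (drop (Suc i) xs) @ xs ! k #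
      take (j - Suc k) (drop (Suc k) xs) @ xs ! j # take (l - Suc j) (drop (Suc j) xs) @ xs ! l #
      drop (Suc l) xs"
    using split[of 0 i] split[of "Suc i" k] split[of "Suc k" j] split[of "Suc j" l] lt by simp
  then obtain p q1 q2 q3 r where
    "xs = p @ (xs ! i # q1 @ xs ! k # q2 @ xs ! j # q3 @ xs ! l # r)" by metis
  then have "graph_cycle E (xs ! i # q1 @ xs ! k # q2 @ xs ! j # q3 @ xs ! l # (r @ p))"
    using graph_cycle_rotate[of E p "xs ! i # q1 @ xs ! k # q2 @ xs ! j # q3 @ xs ! l # r"] cyc by simp
  then show False using cycle_chords_not_crossing_aux ch by blast
qed

end

subsection \<open>Drawing dissected polygons\<close>

text \<open>Pairs are thought of as increasing. One order of interleaving suffices, because both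
  pairs range over all of \<open>D\<close>.\<close>

definition noncrossing :: "(nat \<times> nat) set \<Rightarrow> bool" where
  "noncrossing D \<longleftrightarrow> (\<forall>(a, b)\<in>D. \<forall>(c, d)\<in>D. \<not> (a < c \<and> c < b \<and> b < d))"

lemma noncrossingD: "noncrossing D \<Longrightarrow> (a, b) \<in> D \<Longrightarrow> (c, d) \<in> D \<Longrightarrow> a < c \<Longrightarrow> c < b \<Longrightarrow> b < d \<Longrightarrow> False"
  unfolding noncrossing_def by blast

definition polygon_sides :: "nat \<Rightarrow> (nat \<times> nat) set" where
  "polygon_sides n = insert (0, n - 1) {(i, Suc i) |i. Suc i < n}"

text \<open>Chords are pairs of positions \<open>a < b\<close> on the polygon; its sides are not among them.\<close>

definition dissections :: "nat \<Rightarrow> (nat \<times> nat) set set" where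
  "dissections n =
     {D. D \<subseteq> {(a, b). a + 2 \<le> b \<and> b < n \<and> (a, b) \<noteq> (0, n - 1)} \<and> noncrossing D}"

definition chord_graph :: "'a list \<Rightarrow> (nat \<times> nat) set \<Rightarrow> 'a set set" where
  "chord_graph xs F = (\<lambda>(a, b). {xs ! a, xs ! b}) ` F"

definition dissection_graph :: "'a list \<Rightarrow> (nat \<times> nat) set \<Rightarrow> 'a set set" where
  "dissection_graph xs D = chord_graph xs (D \<union> polygon_sides (length xs))"

lemma chord_graph_Un: "chord_graph xs (F \<union> G) = chord_graph xs F \<union> chord_graph xs G"
  by (auto simp: chord_graph_def)

lemma path_edges_nth: "path_edges xs = (\<lambda>i. {xs ! i, xs ! Suc i}) ` {..<length xs - 1}"
  by (induction xs rule: path_edges.induct) (simp_all add: lessThan_Suc_eq_insert_0 image_image)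

lemma polygon_sides_alt: "polygon_sides n = insert (0, n - 1) ((\<lambda>i. (i, Suc i)) ` {..<n - 1})"
  by (auto simp: polygon_sides_def)

lemma cycle_edges_chord_graph:
  "xs \<noteq> [] \<Longrightarrow> cycle_edges xs = chord_graph xs (polygon_sides (length xs))"
  by (simp add: cycle_edges_def chord_graph_def polygon_sides_alt path_edges_nth
      last_conv_nth hd_conv_nth insert_commute image_image)

lemma dissection_graph_alt:
  "xs \<noteq> [] \<Longrightarrow> dissection_graph xs D = cycle_edges xs \<union> chord_graph xs D"
  by (auto simp: dissection_graph_def chord_graph_Un cycle_edges_chord_graph)

text \<open>A side between consecutive positions has nothing strictly in between, and the closing
  side has nothing beyond its ends.\<close>

lemma noncrossing_dissection_sides:
  assumes "D \<in> dissections n"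
  shows "noncrossing (D \<union> polygon_sides n)"
proof -
  have "noncrossing D" "\<forall>(a, b)\<in>D. b < n" using assms by (auto simp: dissections_def)
  then show ?thesis
    unfolding noncrossing_def polygon_sides_def by fastforce
qed

lemma dissection_sides_bound:
  assumes "D \<in> dissections n" "2 \<le> n" "(a, b) \<in> D \<union> polygon_sides n"
  shows "a < b" "b < n"
  using assms by (auto simp: dissections_def polygon_sides_def)

section \<open>Straight chords of the parabola\<close>

lemma noncrossing_parabola_chords:
  fixes a b c d x :: real
  assumes "a \<le> c" "c < d" "d \<le> b" "(a, b) \<noteq> (c, d)" "c \<le> x" "x \<le> d"
    and eq: "(a + b) * x - a * b = (c + d) * x - c * d"
  shows "x = c \<and> a = c \<or> x = d \<and> b = d"
proof -
  \<comment> \<open>The line through the points of the parabola over \<open>a\<close> and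
    \<open>b\<close> is y = (a + b) x - a b. The expression is the height of the outer chord above
    the inner one, written as a sum of two terms that are nonnegative for nested intervals.\<close>
  have "(c - a) * (b - x) + (x - c) * (b - d) = 0"
    using eq by (simp add: algebra_simps)
  moreover have "0 \<le> (c - a) * (b - x)" "0 \<le> (x - c) * (b - d)"
    using assms by simp_all
  ultimately have "(c - a) * (b - x) = 0" "(x - c) * (b - d) = 0" by linarith+
  then show ?thesis using assms by auto
qed

definition parabola :: "nat \<Rightarrow> complex" where
  "parabola a = Complex (real a) ((real a)\<^sup>2)"

lemma parabola_eq_iff [simp]: "parabola a = parabola b \<longleftrightarrow> a = b"
  by (auto simp: parabola_def)

lemma parabola_segment:
  assumes "z \<in> closed_segment (parabola a) (parabola b)" "a < b"
  shows "real a \<le> Re z" "Re z \<le> real b"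
    "Im z = (real a + real b) * Re z - real a * real b"
proof -
  obtain u where u: "0 \<le> u" "u \<le> 1" "z = (1 - u) *\<^sub>R parabola a + u *\<^sub>R parabola b"
    using assms by (auto simp: in_segment)
  have Re: "Re z = (1 - u) * real a + u * real b"
    and Im: "Im z = (1 - u) * (real a)\<^sup>2 + u * (real b)\<^sup>2"
    by (simp_all add: u(3) parabola_def)
  have x: "Re z = real a + u * (real b - real a)" unfolding Re by (simp add: algebra_simps)
  show "real a \<le> Re z" unfolding x using u(1) assms(2) by simp
  have "real b - Re z = (1 - u) * (real b - real a)" unfolding Re by (simp add: algebra_simps)
  also have "\<dots> \<ge> 0" using u(2) assms(2) by simp
  finally show "Re z \<le> real b" by simp
  show "Im z = (real a + real b) * Re z - real a * real b"
    unfolding Re Im by (simp add: algebra_simps power2_eq_square)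
qed

lemma parabola_segment_Int:
  assumes "a < b" "c < d" "(a, b) \<noteq> (c, d)" "\<not> (a < c \<and> c < b \<and> b < d)" "\<not> (c < a \<and> a < d \<and> d < b)"
    and z: "z \<in> closed_segment (parabola a) (parabola b)" "z \<in> closed_segment (parabola c) (parabola d)"
  shows "z \<in> parabola ` ({a, b} \<inter> {c, d})"
proof -
  note ab = parabola_segment[OF z(1) \<open>a < b\<close>]
  note cd = parabola_segment[OF z(2) \<open>c < d\<close>]
  have eq: "(real a + real b) * Re z - real a * real b = (real c + real d) * Re z - real c * real d"
    using ab cd by simp
  have at: "z = parabola e" if "Re z = real e" "e \<in> {a, b}" for e
    using that ab(3) by (auto simp: parabola_def complex_eq_iff algebra_simps power2_eq_square)
  \<comment> \<open>Without a crossing, the two intervals are separated or nested.\<close>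
  consider "b \<le> c" | "d \<le> a" | "a \<le> c" "d \<le> b" | "c \<le> a" "b \<le> d"
    using assms by linarith
  then have "\<exists>e. Re z = real e \<and> e \<in> {a, b} \<inter> {c, d}"
  proof cases
    case 1
    then have "Re z = real b" "b = c" using ab cd by linarith+
    then show ?thesis by auto
  next
    case 2
    then have "Re z = real a" "a = d" using ab cd by linarith+
    then show ?thesis by auto
  next
    case 3
    then show ?thesis
      using noncrossing_parabola_chords[of a c d b "Re z"] assms cd eq by auto
  next
    case 4
    then show ?thesis
      using noncrossing_parabola_chords[of c a b d "Re z"] assms ab eq by auto
  qed
  then show ?thesis using at by blast
qed

text \<open>The vertical ray below the point avoids everything on or above the parabola. It is
  connected and unbounded, hence in the outer face, and it comes arbitrarily close to the
  point.\<close>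

lemma parabola_on_outer_face:
  assumes D: "D \<subseteq> {z. (Re z)\<^sup>2 \<le> Im z}" and "parabola a \<in> D"
  shows "parabola a \<in> frontier (outside D)"
proof -
  define R where "R = Complex (real a) ` {..<(real a)\<^sup>2}"
  have "continuous_on {..<(real a)\<^sup>2} (Complex (real a))"
    by (auto simp: Complex_eq intro!: continuous_intros)
  then have con: "connected R"
    unfolding R_def by (rule connected_continuous_image) auto
  have sub: "R \<subseteq> - D" using D by (auto simp: R_def)
  have "\<not> bounded R"
  proof
    assume "bounded R"
    then obtain B where B: "\<And>z. z \<in> R \<Longrightarrow> norm z \<le> B" unfolding bounded_iff by blast
    have "Complex (real a) (- \<bar>B\<bar> - 1) \<in> R"
    proof -
      have "- \<bar>B\<bar> - 1 < (real a)\<^sup>2" using zero_le_power2[of "real a"] by linarith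
      then show ?thesis unfolding R_def by blast
    qed
    then have "norm (Complex (real a) (- \<bar>B\<bar> - 1)) \<le> B" by (rule B)
    moreover have "\<bar>Im (Complex (real a) (- \<bar>B\<bar> - 1))\<bar> \<le> norm (Complex (real a) (- \<bar>B\<bar> - 1))"
      by (rule abs_Im_le_cmod)
    ultimately show False by simp
  qed
  then have out: "R \<subseteq> outside D"
  proof (intro subsetI)
    fix x assume "x \<in> R"
    have "\<not> bounded (connected_component_set (- D) x)"
      using connected_component_maximal[OF \<open>x \<in> R\<close> con sub] \<open>\<not> bounded R\<close> bounded_subset by blast
    then show "x \<in> outside D" using sub \<open>x \<in> R\<close> by (auto simp: outside)
  qed
  have "parabola a \<in> closure (outside D)"
  proof (subst closure_approachable, intro allI impI)
    fix e :: real assume "e > 0"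
    then have "Complex (real a) ((real a)\<^sup>2 - e / 2) \<in> outside D" using out by (auto simp: R_def)
    moreover have "dist (Complex (real a) ((real a)\<^sup>2 - e / 2)) (parabola a) < e"
      using \<open>e > 0\<close> by (simp add: dist_norm parabola_def cmod_def)
    ultimately show "\<exists>y\<in>outside D. dist y (parabola a) < e" by blast
  qed
  moreover have "parabola a \<notin> outside D" using assms(2) outside_no_overlap[of D] by blast
  ultimately show ?thesis
    using interior_subset unfolding frontier_def by blast
qed

lemma outerplanar_chord_graph:
  assumes "distinct xs" and F: "\<And>a b. (a, b) \<in> F \<Longrightarrow> a < b \<and> b < length xs" and nc: "noncrossing F"
  shows "outerplanar (set xs) (chord_graph xs F)"
proof -
  define n where "n = length xs"
  define ix where "ix = the_inv_into {..<n} ((!) xs)"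
  have inj: "inj_on ((!) xs) {..<n}" using assms(1) by (auto simp: inj_on_def nth_eq_iff_index_eq n_def)
  have ix: "ix (xs ! i) = i" if "i < n" for i
    unfolding ix_def using that inj by (intro the_inv_into_f_f) auto
  have V: "set xs = (!) xs ` {..<n}" by (auto simp: set_conv_nth n_def)
  define pos where "pos = (\<lambda>v. parabola (ix v))"
  \<comment> \<open>Edges are unordered, so the segment is directed from the smaller to the larger
    position.\<close>
  define \<gamma> where "\<gamma> = (\<lambda>e. linepath (parabola (Min (ix ` e))) (parabola (Max (ix ` e))))"
  have lt: "a < b" "a < n" "b < n" if "(a, b) \<in> F" for a b using F[OF that] by (auto simp: n_def)
  have \<gamma>: "\<gamma> {xs ! a, xs ! b} = linepath (parabola a) (parabola b)" if "(a, b) \<in> F" for a b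
    using lt[OF that] ix[of a] ix[of b] by (simp add: \<gamma>_def min_def max_def)
  have pos: "pos (xs ! i) = parabola i" if "i < n" for i using ix[OF that] by (simp add: pos_def)
  have emb: "plane_embedding (set xs) (chord_graph xs F) pos \<gamma>"
    unfolding plane_embedding_def
  proof (intro conjI ballI impI)
    show "inj_on pos (set xs)" by (auto simp: V inj_on_def pos)
  next
    fix e assume "e \<in> chord_graph xs F"
    then obtain a b where e: "e = {xs ! a, xs ! b}" "(a, b) \<in> F" by (auto simp: chord_graph_def)
    note [simp] = \<gamma>[OF e(2)] lt[OF e(2)] pos
    show "arc (\<gamma> e)" using less_imp_neq[OF lt(1)[OF e(2)]] by (auto simp: e intro!: arc_linepath)
    show "{pathstart (\<gamma> e), pathfinish (\<gamma> e)} = pos ` e" by (simp add: e)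
    \<comment> \<open>A line meets the parabola in at most two points, so a chord passes through no
      third vertex.\<close>
    have on_seg: "parabola c \<in> {parabola a, parabola b}"
      if "parabola c \<in> closed_segment (parabola a) (parabola b)" for c
    proof -
      have "(real c)\<^sup>2 = (real a + real b) * real c - real a * real b"
        using parabola_segment(3)[OF that lt(1)[OF e(2)]] by (simp add: parabola_def)
      then have "(real c - real a) * (real c - real b) = 0" by (simp add: algebra_simps power2_eq_square)
      then show ?thesis by auto
    qed
    have "pos ` set xs = parabola ` {..<n}" unfolding V image_image by (rule image_cong) auto
    moreover have "{parabola a, parabola b} \<subseteq> parabola ` {..<n}" by simp
    ultimately have "path_image (\<gamma> e) \<inter> pos ` set xs = {parabola a, parabola b}"
      using on_seg by (auto simp del: parabola_eq_iff simp: e)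
    then show "path_image (\<gamma> e) \<inter> pos ` set xs = pos ` e" by (simp add: e)
  next
    fix e f assume "e \<in> chord_graph xs F" "f \<in> chord_graph xs F" "e \<noteq> f"
    then obtain a b c d where e: "e = {xs ! a, xs ! b}" "(a, b) \<in> F"
      and f: "f = {xs ! c, xs ! d}" "(c, d) \<in> F" "(a, b) \<noteq> (c, d)" by (auto simp: chord_graph_def)
    note [simp] = \<gamma>[OF e(2)] lt[OF e(2)] \<gamma>[OF f(2)] lt[OF f(2)] pos
    have ef: "e \<inter> f = (!) xs ` ({a, b} \<inter> {c, d})"
      unfolding e f using inj lt[OF e(2)] lt[OF f(2)] by (auto simp: inj_on_def)
    have eq: "pos ` (e \<inter> f) = parabola ` ({a, b} \<inter> {c, d})"
      unfolding ef image_image by (rule image_cong) auto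
    have sub: "path_image (\<gamma> e) \<inter> path_image (\<gamma> f) \<subseteq> parabola ` ({a, b} \<inter> {c, d})"
      using parabola_segment_Int[OF lt(1)[OF e(2)] lt(1)[OF f(2)] f(3)] noncrossingD[OF nc e(2) f(2)]
        noncrossingD[OF nc f(2) e(2)] by (auto simp: e f)
    have sup: "parabola ` ({a, b} \<inter> {c, d}) \<subseteq> path_image (\<gamma> e) \<inter> path_image (\<gamma> f)"
      by (auto simp: e f)
    show "path_image (\<gamma> e) \<inter> path_image (\<gamma> f) = pos ` (e \<inter> f)"
      unfolding eq by (rule subset_antisym[OF sub sup])
  qed
  let ?D = "drawing (set xs) (chord_graph xs F) pos \<gamma>"
  have "(Re z)\<^sup>2 \<le> Im z" if ze: "z \<in> path_image (\<gamma> e)" "e \<in> chord_graph xs F" for z e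
  proof -
    obtain a b where e: "e = {xs ! a, xs ! b}" "(a, b) \<in> F" using ze(2) by (auto simp: chord_graph_def)
    note s = parabola_segment[of z a b, OF _ lt(1)[OF e(2)]]
    have z: "z \<in> closed_segment (parabola a) (parabola b)" using ze(1) \<gamma>[OF e(2)] e by simp
    \<comment> \<open>Expanded, this says that a chord lies above the parabola between its
      ends.\<close>
    have "0 \<le> (Re z - real a) * (real b - Re z)" using s[OF z] by simp
    then show ?thesis using s(3)[OF z] by (simp add: algebra_simps power2_eq_square)
  qed
  then have "?D \<subseteq> {z. (Re z)\<^sup>2 \<le> Im z}"
    by (auto simp: drawing_def V pos) (simp add: parabola_def)
  then have "pos ` set xs \<subseteq> frontier (outside ?D)"
  proof (intro image_subsetI)
    fix v assume v: "v \<in> set xs"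
    then have "parabola (ix v) \<in> ?D" by (auto simp: drawing_def pos_def)
    then show "pos v \<in> frontier (outside ?D)"
      using parabola_on_outer_face \<open>?D \<subseteq> {z. (Re z)\<^sup>2 \<le> Im z}\<close> unfolding pos_def by blast
  qed
  then show ?thesis using emb unfolding outerplanar_def by blast
qed

subsection \<open>Uniqueness of the Hamilton cycle\<close>

abbreviation edge_rel :: "'a set \<Rightarrow> 'a set set \<Rightarrow> ('a \<times> 'a) set" where
  "edge_rel W E \<equiv> {(x, y). x \<in> W \<and> y \<in> W \<and> {x, y} \<in> E}"

lemma sym_edge_rel: "sym (edge_rel W E)"
  by (auto simp: sym_def insert_commute)

lemma edge_rel_rtrancl_sym: "(u, v) \<in> (edge_rel W E)\<^sup>* \<Longrightarrow> (v, u) \<in> (edge_rel W E)\<^sup>*"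
  by (rule symD[OF sym_rtrancl[OF sym_edge_rel]])

lemma connected_graphI_base:
  assumes "b \<in> W" "\<And>v. v \<in> W \<Longrightarrow> (v, b) \<in> (edge_rel W E)\<^sup>*"
  shows "connected_graph W E"
proof -
  have "(u, v) \<in> (edge_rel W E)\<^sup>*" if "u \<in> W" "v \<in> W" for u v
    using assms(2)[OF that(1)] edge_rel_rtrancl_sym[OF assms(2)[OF that(2)]]
    by (rule rtrancl_trans)
  then show ?thesis using assms(1) unfolding connected_graph_def by auto
qed

lemma polygon_range_connected:
  assumes "cycle_edges xs \<subseteq> E" "i \<le> j" "j < length xs" "(!) xs ` {i..j} \<subseteq> W"
  shows "(xs ! i, xs ! j) \<in> (edge_rel W E)\<^sup>*"
  using assms(2-4)
proof (induction rule: dec_induct)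
  case (step k)
  have "{xs ! k, xs ! Suc k} \<in> E"
    using assms(1) step.prems(1) by (auto simp: cycle_edges_def path_edges_nth)
  moreover have "xs ! k \<in> W" "xs ! Suc k \<in> W" using step by auto
  moreover have "(xs ! i, xs ! k) \<in> (edge_rel W E)\<^sup>*"
    using step by (auto simp: image_subset_iff)
  ultimately show ?case by (auto intro: rtrancl.rtrancl_into_rtrancl)
qed simp

lemma polygon_segment_connected:
  assumes "cycle_edges xs \<subseteq> E" "i < j" "j \<le> length xs"
  shows "connected_graph ((!) xs ` {i..<j}) E"
proof (rule connected_graphI_base)
  show "xs ! (j - 1) \<in> (!) xs ` {i..<j}" using assms by auto
  fix v assume "v \<in> (!) xs ` {i..<j}"
  then obtain k where k: "v = xs ! k" "i \<le> k" "k < j" by auto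
  show "(v, xs ! (j - 1)) \<in> (edge_rel ((!) xs ` {i..<j}) E)\<^sup>*"
    unfolding k by (rule polygon_range_connected[OF assms(1)]) (use k assms in auto)
qed

text \<open>What remains of the cycle are two stretches joined by the closing edge from the last to
  the first position. For \<open>i = 0\<close> there is only one stretch.\<close>

lemma polygon_complement_connected:
  assumes E: "cycle_edges xs \<subseteq> E" and ij: "i \<le> j" "j \<le> length xs" "0 < i \<or> j < length xs"
  shows "connected_graph ((!) xs ` ({..<i} \<union> {j..<length xs})) E"
proof (cases "i = 0")
  case True
  then show ?thesis using polygon_segment_connected[OF E, of j "length xs"] ij by simp
next
  case False
  define W where "W = (!) xs ` ({..<i} \<union> {j..<length xs})"
  have ne: "xs \<noteq> []" using False ij by auto
  have 0: "xs ! 0 \<in> W" using False by (auto simp: W_def)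
  show ?thesis
    unfolding W_def[symmetric]
  proof (rule connected_graphI_base[OF 0])
    fix v assume "v \<in> W"
    then obtain k where k: "v = xs ! k" "k < i \<or> j \<le> k" "k < length xs" using ij by (auto simp: W_def)
    show "(v, xs ! 0) \<in> (edge_rel W E)\<^sup>*"
    proof (cases "k < i")
      case True
      have "(xs ! 0, xs ! k) \<in> (edge_rel W E)\<^sup>*"
        by (rule polygon_range_connected[OF E]) (use k True in \<open>auto simp: W_def\<close>)
      then show ?thesis unfolding k by (rule edge_rel_rtrancl_sym)
    next
      case False
      let ?m = "length xs - 1"
      have "(xs ! k, xs ! ?m) \<in> (edge_rel W E)\<^sup>*"
        by (rule polygon_range_connected[OF E]) (use k False in \<open>auto simp: W_def\<close>)
      moreover have "{xs ! ?m, xs ! 0} \<in> E"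
        using E ne by (auto simp: cycle_edges_def last_conv_nth hd_conv_nth)
      moreover have "xs ! ?m \<in> W" using k False by (auto simp: W_def intro!: imageI)
      ultimately show ?thesis unfolding k using 0 by (auto intro: rtrancl.rtrancl_into_rtrancl)
    qed
  qed
qed

lemma set_minus_nth:
  assumes "distinct xs" "I \<subseteq> {..<length xs}"
  shows "set xs - (!) xs ` I = (!) xs ` ({..<length xs} - I)"
proof -
  have "inj_on ((!) xs) {..<length xs}" using assms(1) by (auto simp: inj_on_def nth_eq_iff_index_eq)
  moreover have "set xs = (!) xs ` {..<length xs}" by (auto simp: set_conv_nth)
  ultimately show ?thesis using assms(2) by (simp add: inj_on_image_set_diff)
qed

lemma two_connected_polygon:
  assumes dis: "distinct xs" and E: "cycle_edges xs \<subseteq> E" and len: "2 \<le> length xs"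
  shows "two_connected (set xs) E"
  unfolding two_connected_def
proof (intro conjI ballI)
  have V: "set xs = (!) xs ` {..<length xs}" by (auto simp: set_conv_nth)
  show "2 \<le> card (set xs)" using dis len by (simp add: distinct_card)
  show "connected_graph (set xs) E"
    unfolding V lessThan_atLeast0 by (rule polygon_segment_connected[OF E]) (use len in auto)
  fix x assume "x \<in> set xs"
  then obtain m where m: "m < length xs" "x = xs ! m" by (auto simp: in_set_conv_nth)
  have "set xs - {x} = (!) xs ` ({..<length xs} - {m})"
    using set_minus_nth[OF dis, of "{m}"] m by simp
  also have "{..<length xs} - {m} = {..<m} \<union> {Suc m..<length xs}" using m by auto
  finally have "set xs - {x} = (!) xs ` ({..<m} \<union> {Suc m..<length xs})" .
  moreover have "0 < m \<or> Suc m < length xs" using len by arith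
  ultimately show "connected_graph (set xs - {x}) E"
    using polygon_complement_connected[OF E, of m "Suc m"] m by simp
qed

definition hamilton_edges :: "'a set \<Rightarrow> 'a set set \<Rightarrow> 'a set set" where
  "hamilton_edges V E = {e \<in> E. connected_graph (V - e) E}"

text \<open>The positions strictly between \<open>a\<close> and \<open>b\<close> are closed under
  the remaining edges, since leaving them would mean crossing the chord. They include
  \<open>Suc a\<close>, and some position lies beyond the chord.\<close>

lemma chord_separates:
  assumes dis: "distinct xs" and nc: "noncrossing F" and ab: "(a, b) \<in> F" "a + 2 \<le> b" "b < length xs"
    "(a, b) \<noteq> (0, length xs - 1)" and F: "\<And>a b. (a, b) \<in> F \<Longrightarrow> a < b \<and> b < length xs"
  shows "\<not> connected_graph (set xs - {xs ! a, xs ! b}) (chord_graph xs F)"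
proof
  let ?W = "set xs - {xs ! a, xs ! b}"
  let ?R = "edge_rel ?W (chord_graph xs F)"
  assume con: "connected_graph ?W (chord_graph xs F)"
  have eq: "xs ! p = xs ! q \<longleftrightarrow> p = q" if "p < length xs" "q < length xs" for p q
    using dis that by (simp add: nth_eq_iff_index_eq)
  \<comment> \<open>A position beyond the chord exists because the chord is not the closing
    side.\<close>
  have "\<exists>c<length xs. c < a \<or> b < c"
  proof (cases "0 < a")
    case True
    then show ?thesis using ab(2,3) by (intro exI[of _ 0]) linarith
  next
    case False
    then have "b < length xs - 1" using ab(3,4) by simp
    then show ?thesis using ab(3) by (intro exI[of _ "length xs - 1"]) linarith
  qed
  then obtain c where c: "c < length xs" "c < a \<or> b < c" by blast
  define S where "S = (!) xs ` {a<..<b}"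
  have closed: "y \<in> S" if xy: "(x, y) \<in> ?R" "x \<in> S" for x y
  proof -
    obtain p where p: "x = xs ! p" "a < p" "p < b" using xy by (auto simp: S_def)
    obtain q where q: "y = xs ! q" "q < length xs" using xy by (auto simp: in_set_conv_nth)
    have qn: "q \<noteq> a" "q \<noteq> b" using xy q by auto
    have "{xs ! p, xs ! q} \<in> chord_graph xs F" using xy p q by simp
    then obtain s t where st: "(s, t) \<in> F" "{xs ! p, xs ! q} = {xs ! s, xs ! t}"
      by (auto simp: chord_graph_def)
    have "s < length xs" "t < length xs" using F[OF st(1)] by auto
    then have "(p, q) \<in> F \<or> (q, p) \<in> F"
      using st q p ab eq by (auto simp: doubleton_eq_iff)
    then have "a < q \<and> q < b"
    proof
      assume pq: "(p, q) \<in> F"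
      have "\<not> b < q" using noncrossingD[OF nc ab(1) pq] p by blast
      then show ?thesis using F[OF pq] p qn by linarith
    next
      assume qp: "(q, p) \<in> F"
      have "\<not> q < a" using noncrossingD[OF nc qp ab(1)] p by blast
      then show ?thesis using F[OF qp] p qn by linarith
    qed
    then show ?thesis using q by (auto simp: S_def)
  qed
  have start: "xs ! Suc a \<in> S" "xs ! Suc a \<in> ?W" using ab eq by (auto simp: S_def)
  have "xs ! c \<in> ?W" using c ab eq by auto
  then have "(xs ! Suc a, xs ! c) \<in> ?R\<^sup>*" using con start unfolding connected_graph_def by blast
  then have "xs ! c \<in> S"
    by (induction rule: rtrancl_induct) (use start closed in blast)+
  then show False using c ab eq by (auto simp: S_def)
qed

text \<open>Deleting the ends of a side leaves a stretch of the cycle, deleting the ends of a chord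
  separates. With at least three vertices the stretch is nonempty, as \<open>connected_graph\<close>
  demands.\<close>

lemma hamilton_edges_dissection_graph:
  assumes dis: "distinct xs" and D: "D \<in> dissections (length xs)" and len: "3 \<le> length xs"
  shows "hamilton_edges (set xs) (dissection_graph xs D) = cycle_edges xs"
proof -
  let ?n = "length xs" and ?E = "dissection_graph xs D"
  have ne: "xs \<noteq> []" using len by auto
  have cyc: "cycle_edges xs \<subseteq> ?E" using dissection_graph_alt[OF ne] by blast
  have F: "a < b \<and> b < ?n" if "(a, b) \<in> D \<union> polygon_sides ?n" for a b
    using dissection_sides_bound[OF D _ that] len by auto
  have side: "connected_graph (set xs - {xs ! a, xs ! b}) ?E \<longleftrightarrow> (a, b) \<in> polygon_sides ?n"
    if ab: "(a, b) \<in> D \<union> polygon_sides ?n" for a b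
  proof
    assume con: "connected_graph (set xs - {xs ! a, xs ! b}) ?E"
    show "(a, b) \<in> polygon_sides ?n"
    proof (rule ccontr)
      assume "(a, b) \<notin> polygon_sides ?n"
      then have "(a, b) \<in> D" using ab by blast
      then have "a + 2 \<le> b" "b < ?n" "(a, b) \<noteq> (0, ?n - 1)" using D by (auto simp: dissections_def)
      then show False
        using chord_separates[OF dis noncrossing_dissection_sides[OF D] ab _ _ _ F] con
        unfolding dissection_graph_def by blast
    qed
  next
    assume "(a, b) \<in> polygon_sides ?n"
    then consider "a = 0" "b = ?n - 1" | "b = Suc a" "Suc a < ?n" by (auto simp: polygon_sides_def)
    then show "connected_graph (set xs - {xs ! a, xs ! b}) ?E"
    proof cases
      case 1
      have "{..<?n} - {a, b} = {1..<?n - 1}" "{a, b} \<subseteq> {..<?n}" using 1 len by auto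
      then have "set xs - {xs ! a, xs ! b} = (!) xs ` {1..<?n - 1}"
        using set_minus_nth[OF dis, of "{a, b}"] by simp
      then show ?thesis
        using polygon_segment_connected[OF cyc, of 1 "?n - 1"] len by simp
    next
      case 2
      have "{..<?n} - {a, b} = {..<a} \<union> {Suc b..<?n}" using 2 by auto
      then have "set xs - {xs ! a, xs ! b} = (!) xs ` ({..<a} \<union> {Suc b..<?n})"
        using set_minus_nth[OF dis, of "{a, b}"] 2 by simp
      moreover have "0 < a \<or> Suc b < ?n" using 2 len by arith
      ultimately show ?thesis
        using polygon_complement_connected[OF cyc, of a "Suc b"] 2 by simp
    qed
  qed
  have "hamilton_edges (set xs) ?E = chord_graph xs (polygon_sides ?n)"
  proof
    show "hamilton_edges (set xs) ?E \<subseteq> chord_graph xs (polygon_sides ?n)"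
    proof
      fix e assume e: "e \<in> hamilton_edges (set xs) ?E"
      then obtain a b where "(a, b) \<in> D \<union> polygon_sides ?n" "e = {xs ! a, xs ! b}"
        by (auto simp: hamilton_edges_def dissection_graph_def chord_graph_def)
      with side e show "e \<in> chord_graph xs (polygon_sides ?n)"
        by (auto simp: hamilton_edges_def chord_graph_def)
    qed
    show "chord_graph xs (polygon_sides ?n) \<subseteq> hamilton_edges (set xs) ?E"
    proof
      fix e assume "e \<in> chord_graph xs (polygon_sides ?n)"
      then obtain a b where ab: "(a, b) \<in> polygon_sides ?n" "e = {xs ! a, xs ! b}"
        by (auto simp: chord_graph_def)
      then have "e \<in> ?E" by (auto simp: dissection_graph_def chord_graph_def)
      with side[of a b] ab show "e \<in> hamilton_edges (set xs) ?E" by (simp add: hamilton_edges_def)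
    qed
  qed
  then show ?thesis using cycle_edges_chord_graph[OF ne] by simp
qed

lemma chord_graph_mem_iff:
  assumes "distinct xs" "\<And>a b. (a, b) \<in> F \<Longrightarrow> a < b \<and> b < length xs" "a < b" "b < length xs"
  shows "{xs ! a, xs ! b} \<in> chord_graph xs F \<longleftrightarrow> (a, b) \<in> F"
proof
  assume "{xs ! a, xs ! b} \<in> chord_graph xs F"
  then obtain c d where cd: "(c, d) \<in> F" "{xs ! a, xs ! b} = {xs ! c, xs ! d}"
    by (auto simp: chord_graph_def)
  moreover have "c < d" "d < length xs" using assms(2)[OF cd(1)] by auto
  ultimately have "a = c \<and> b = d \<or> a = d \<and> b = c"
    using assms by (auto simp: doubleton_eq_iff nth_eq_iff_index_eq)
  then show "(a, b) \<in> F" using cd \<open>c < d\<close> assms(3) by auto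
qed (auto simp: chord_graph_def)

lemma inj_on_dissection_graph:
  assumes "distinct xs" "3 \<le> length xs"
  shows "inj_on (dissection_graph xs) (dissections (length xs))"
proof (rule inj_onI)
  have sub: "D \<subseteq> D'" if D: "D \<in> dissections (length xs)" "D' \<in> dissections (length xs)"
    and eq: "dissection_graph xs D = dissection_graph xs D'" for D D'
  proof (rule subrelI)
    fix a b assume ab: "(a, b) \<in> D"
    then have ab': "a + 2 \<le> b" "b < length xs" "(a, b) \<noteq> (0, length xs - 1)"
      using D by (auto simp: dissections_def)
    have F: "\<And>a b. (a, b) \<in> D' \<union> polygon_sides (length xs) \<Longrightarrow> a < b \<and> b < length xs"
      using dissection_sides_bound[OF D(2)] assms(2) by auto
    have "{xs ! a, xs ! b} \<in> dissection_graph xs D'"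
      using ab eq[symmetric] by (auto simp: dissection_graph_def chord_graph_def)
    then have "(a, b) \<in> D' \<union> polygon_sides (length xs)"
      unfolding dissection_graph_def using chord_graph_mem_iff[of xs "D' \<union> polygon_sides (length xs)" a b, OF assms(1) F] ab'
      by linarith
    then show "(a, b) \<in> D'" using ab' by (auto simp: polygon_sides_def)
  qed
  fix D D' assume "D \<in> dissections (length xs)" "D' \<in> dissections (length xs)"
    "dissection_graph xs D = dissection_graph xs D'"
  then show "D = D'" using sub[of D D'] sub[of D' D] by auto
qed

text \<open>The last position is the larger entry of every pair it belongs to, so its chords are
  counted by one set of first entries. The 2 stands for its cycle neighbours, at the positions
  \<open>0\<close> and \<open>length xs - 2\<close>.\<close>

lemma vertex_degree_dissection_graph:
  assumes dis: "distinct xs" and D: "D \<in> dissections (length xs)" and len: "3 \<le> length xs"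
  shows "vertex_degree (dissection_graph xs D) (last xs) = 2 + card {a. (a, length xs - 1) \<in> D}"
proof -
  let ?n = "length xs" and ?A = "{a. (a, length xs - 1) \<in> D}"
  have ne: "xs \<noteq> []" using len by auto
  have F: "a < b \<and> b < ?n" if "(a, b) \<in> D \<union> polygon_sides ?n" for a b
    using dissection_sides_bound[OF D _ that] len by auto
  have "{u, last xs} \<in> dissection_graph xs D \<longleftrightarrow> u \<in> (!) xs ` (insert 0 (insert (?n - 2) ?A))" for u
  proof
    assume "{u, last xs} \<in> dissection_graph xs D"
    then obtain a b where ab: "(a, b) \<in> D \<union> polygon_sides ?n" "{u, xs ! (?n - 1)} = {xs ! a, xs ! b}"
      using ne by (auto simp: dissection_graph_def chord_graph_def last_conv_nth)
    have "a \<noteq> ?n - 1" "a < ?n" "b < ?n" using F[OF ab(1)] by auto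
    then have "b = ?n - 1" "u = xs ! a"
      using ab(2) dis by (auto simp: doubleton_eq_iff nth_eq_iff_index_eq)
    then have "a \<in> insert 0 (insert (?n - 2) ?A)" using ab(1) by (auto simp: polygon_sides_def)
    then show "u \<in> (!) xs ` (insert 0 (insert (?n - 2) ?A))" using \<open>u = xs ! a\<close> by blast
  next
    assume "u \<in> (!) xs ` (insert 0 (insert (?n - 2) ?A))"
    then obtain a where a: "a = 0 \<or> a = ?n - 2 \<or> (a, ?n - 1) \<in> D" "u = xs ! a" by auto
    have "Suc (?n - 2) = ?n - 1" "?n - 1 < ?n" using len by auto
    then have "(a, ?n - 1) \<in> D \<union> polygon_sides ?n"
      using a(1) by (auto simp: polygon_sides_def)
    then show "{u, last xs} \<in> dissection_graph xs D"
      using a ne by (force simp: dissection_graph_def chord_graph_def last_conv_nth)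
  qed
  then have "{u. {u, last xs} \<in> dissection_graph xs D} = (!) xs ` (insert 0 (insert (?n - 2) ?A))"
    by blast
  then have "vertex_degree (dissection_graph xs D) (last xs) =
      card ((!) xs ` (insert 0 (insert (?n - 2) ?A)))"
    unfolding vertex_degree_def by (rule arg_cong)
  moreover have A: "?A \<subseteq> {..<?n}"
  proof
    fix a assume "a \<in> ?A"
    then show "a \<in> {..<?n}" using F[of a "?n - 1"] by auto
  qed
  moreover have "card ((!) xs ` (insert 0 (insert (?n - 2) ?A))) = card (insert 0 (insert (?n - 2) ?A))"
  proof (rule card_image)
    have "insert 0 (insert (?n - 2) ?A) \<subseteq> {..<?n}" using A len by auto
    moreover have "inj_on ((!) xs) {..<?n}" using dis by (auto simp: inj_on_def nth_eq_iff_index_eq)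
    ultimately show "inj_on ((!) xs) (insert 0 (insert (?n - 2) ?A))" by (rule inj_on_subset[rotated])
  qed
  moreover have "card (insert 0 (insert (?n - 2) ?A)) = 2 + card ?A"
  proof -
    have "finite ?A" using A by (rule finite_subset) simp
    moreover have "0 \<notin> ?A" "?n - 2 \<notin> ?A" using D len by (auto simp: dissections_def)
    moreover have "0 \<noteq> ?n - 2" using len by auto
    ultimately show ?thesis by simp
  qed
  ultimately show ?thesis by (simp only:)
qed

lemma (in outerplanar_drawing) dissection_of_cycle:
  assumes cyc: "graph_cycle E xs" and V: "set xs = V"
  obtains D where "D \<in> dissections (length xs)" "E = dissection_graph xs D"
proof -
  let ?n = "length xs"
  have xs: "distinct xs" "3 \<le> ?n" "cycle_edges xs \<subseteq> E" "xs \<noteq> []"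
    using cyc by (auto simp: graph_cycle_def)
  define D where "D = {(a, b). a + 2 \<le> b \<and> b < ?n \<and> (a, b) \<noteq> (0, ?n - 1) \<and> {xs ! a, xs ! b} \<in> E}"
  have "noncrossing D"
    unfolding noncrossing_def
  proof (clarify)
    fix a b c d assume "(a, b) \<in> D" "(c, d) \<in> D" "a < c" "c < b" "b < d"
    then show False using cycle_chords_not_crossing[OF cyc, of a c b d] by (auto simp: D_def)
  qed
  then have "D \<in> dissections ?n" by (auto simp: dissections_def D_def)
  moreover have "E = dissection_graph xs D"
  proof
    show "dissection_graph xs D \<subseteq> E"
      using xs by (auto simp: dissection_graph_alt chord_graph_def D_def)
    show "E \<subseteq> dissection_graph xs D"
    proof
      fix e assume e: "e \<in> E"
      then obtain u v where uv: "e = {u, v}" "u \<in> V" "v \<in> V" "u \<noteq> v"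
        using simple unfolding simple_graph_def by blast
      then obtain i j where ij: "u = xs ! i" "i < ?n" "v = xs ! j" "j < ?n"
        unfolding V[symmetric] in_set_conv_nth by blast
      then have "i \<noteq> j" using uv by auto
      then have "e = {xs ! min i j, xs ! max i j} \<and> min i j < max i j \<and> max i j < ?n"
        using uv(1) ij by (auto simp: min_def max_def)
      then obtain a b where "e = {xs ! a, xs ! b}" "a < b" "b < ?n" by blast
      moreover from this have "(a, b) \<in> D \<union> polygon_sides ?n"
        using e by (cases "b = Suc a") (auto simp: D_def polygon_sides_def)
      ultimately show "e \<in> dissection_graph xs D"
        by (auto simp: dissection_graph_def chord_graph_def)
    qed
  qed
  ultimately show ?thesis using that by blast
qed

subsection \<open>Reduction to polygon dissections\<close>

lemma simple_graph_dissection_graph: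
  assumes "distinct xs" "D \<in> dissections (length xs)" "2 \<le> length xs"
  shows "simple_graph (set xs) (dissection_graph xs D)"
proof -
  have "{xs ! a, xs ! b} \<in> {{u, v} |u v. u \<in> set xs \<and> v \<in> set xs \<and> u \<noteq> v}"
    if "(a, b) \<in> D \<union> polygon_sides (length xs)" for a b
  proof -
    have "a < b" "b < length xs" using dissection_sides_bound[OF assms(2,3) that] by auto
    then have "xs ! a \<in> set xs" "xs ! b \<in> set xs" "xs ! a \<noteq> xs ! b"
      using assms(1) by (auto simp: nth_eq_iff_index_eq)
    then show ?thesis by blast
  qed
  then have "dissection_graph xs D \<subseteq> {{u, v} |u v. u \<in> set xs \<and> v \<in> set xs \<and> u \<noteq> v}"
    unfolding dissection_graph_def chord_graph_def by (intro image_subsetI) (clarify, blast)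
  then show ?thesis by (simp add: simple_graph_def)
qed

lemma dissection_graph_outerplanar:
  assumes "distinct xs" "set xs = {1..n}" "D \<in> dissections n" "3 \<le> n"
  shows "dissection_graph xs D \<in> two_connected_outerplanar_graphs n"
proof -
  have len: "length xs = n" using assms(1,2) distinct_card by fastforce
  then have ne: "xs \<noteq> []" using assms(4) by auto
  have "two_connected (set xs) (dissection_graph xs D)"
    using assms len ne by (intro two_connected_polygon) (auto simp: dissection_graph_alt)
  moreover have "outerplanar (set xs) (dissection_graph xs D)"
    unfolding dissection_graph_def
    using assms len dissection_sides_bound[OF assms(3)] noncrossing_dissection_sides[OF assms(3)]
    by (intro outerplanar_chord_graph) auto
  moreover have "simple_graph (set xs) (dissection_graph xs D)"
    using assms len by (intro simple_graph_dissection_graph) auto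
  ultimately show ?thesis using assms(2) by (simp add: two_connected_outerplanar_graphs_def)
qed

lemma dissection_of_outerplanar_cycle:
  assumes "E \<in> two_connected_outerplanar_graphs n" "graph_cycle E xs" "set xs = {1..n}"
  obtains D where "D \<in> dissections n" "E = dissection_graph xs D"
proof -
  have G: "simple_graph {1..n} E" "outerplanar {1..n} E"
    using assms(1) by (auto simp: two_connected_outerplanar_graphs_def)
  then obtain pos \<gamma> where "outerplanar_drawing {1..n} E pos \<gamma>"
    unfolding outerplanar_def outerplanar_drawing_def by blast
  then interpret outerplanar_drawing "{1..n}" E pos \<gamma> .
  have "length xs = n" using assms(2,3) distinct_card[of xs] by (simp add: graph_cycle_def)
  then show ?thesis using dissection_of_cycle[OF assms(2,3)] that by metis
qed

lemma outerplanar_hamilton_cycle: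
  assumes E: "E \<in> two_connected_outerplanar_graphs n" and n: "3 \<le> n" and v: "v \<in> {1..n}"
  obtains xs where "graph_cycle E xs" "set xs = {1..n}" "last xs = v"
proof -
  have G: "simple_graph {1..n} E" "two_connected {1..n} E" "outerplanar {1..n} E"
    using E by (auto simp: two_connected_outerplanar_graphs_def)
  then obtain pos \<gamma> where "outerplanar_drawing {1..n} E pos \<gamma>"
    unfolding outerplanar_def outerplanar_drawing_def by blast
  then interpret outerplanar_drawing "{1..n}" E pos \<gamma> .
  obtain xs where xs: "graph_cycle E xs" "set xs = {1..n}"
    by (rule Hamiltonian[OF G(2)]) (use n in auto)
  then obtain p s where ps: "xs = p @ v # s" using v by (metis split_list)
  have "graph_cycle E (s @ p @ [v])"
    using graph_cycle_rotate[of E "p @ [v]" s] xs(1) ps by simp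
  moreover have "set (s @ p @ [v]) = {1..n}" using xs(2) ps by auto
  ultimately show ?thesis using that[of "s @ p @ [v]"] by simp
qed

text \<open>Each fibre of \<open>hamilton_edges\<close> is in bijection with the dissections: all
  its graphs share a cycle, which can be written with \<open>v\<close> last. The predicate
  \<open>P\<close> is general so that the trivial one gives the total, with the same first
  factor.\<close>

lemma card_outerplanar_graphs_by_degree:
  assumes n: "3 \<le> n" and v: "v \<in> {1..n}"
  shows "card {E \<in> two_connected_outerplanar_graphs n. P (vertex_degree E v)} =
    card (hamilton_edges {1..n} ` two_connected_outerplanar_graphs n) *
      card {D \<in> dissections n. P (2 + card {a. (a, n - 1) \<in> D})}"
proof -
  define G where "G = two_connected_outerplanar_graphs n"
  define h where "h = hamilton_edges {1..n}"
  define S where "S = {E \<in> G. P (vertex_degree E v)}"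
  have "G \<subseteq> Pow (Pow {1..n})"
    by (auto simp: G_def two_connected_outerplanar_graphs_def simple_graph_def)
  then have fin: "finite G" by (rule finite_subset) simp
  have "card {E \<in> S. h E = H} = card {D \<in> dissections n. P (2 + card {a. (a, n - 1) \<in> D})}"
    if "H \<in> h ` G" for H
  proof -
    obtain E where E: "E \<in> G" "H = h E" using \<open>H \<in> h ` G\<close> by blast
    obtain xs where xs: "graph_cycle E xs" "set xs = {1..n}" "last xs = v"
      using outerplanar_hamilton_cycle[of E n v] E n v G_def by blast
    have dis: "distinct xs" using xs(1) by (simp add: graph_cycle_def)
    have len: "length xs = n" using dis xs(2) distinct_card[of xs] by simp
    have ham: "h (dissection_graph xs D) = cycle_edges xs" if "D \<in> dissections n" for D
      using hamilton_edges_dissection_graph[OF dis, of D] that n len xs(2) by (simp add: h_def)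
    have deg: "vertex_degree (dissection_graph xs D) v = 2 + card {a. (a, n - 1) \<in> D}"
      if "D \<in> dissections n" for D
      using vertex_degree_dissection_graph[OF dis, of D] that n len xs(3) by simp
    obtain D0 where "D0 \<in> dissections n" "E = dissection_graph xs D0"
      using dissection_of_outerplanar_cycle[of E n xs] E(1) xs G_def by blast
    then have H: "H = cycle_edges xs" using ham E(2) by simp
    have "{E \<in> S. h E = H} =
      dissection_graph xs ` {D \<in> dissections n. P (2 + card {a. (a, n - 1) \<in> D})}" (is "?L = ?R")
    proof
      show "?L \<subseteq> ?R"
      proof
        fix E' assume E': "E' \<in> ?L"
        \<comment> \<open>Every graph in the fibre contains the edges of \<open>xs\<close>, so the
          same list, with \<open>v\<close> last, serves for all of them.\<close>
        then have "cycle_edges xs \<subseteq> E'" unfolding H h_def hamilton_edges_def by blast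
        then have "graph_cycle E' xs" using xs(1) by (simp add: graph_cycle_def)
        then obtain D where "D \<in> dissections n" "E' = dissection_graph xs D"
          using dissection_of_outerplanar_cycle[of E' n xs] E' xs(2) S_def G_def by blast
        then show "E' \<in> ?R" using E' deg by (auto simp: S_def)
      qed
      show "?R \<subseteq> ?L"
        using ham deg dissection_graph_outerplanar[OF dis xs(2) _ n] by (auto simp: S_def G_def H)
    qed
    moreover have "inj_on (dissection_graph xs) (dissections n)"
      using inj_on_dissection_graph[OF dis] n len by simp
    ultimately show ?thesis
      by (simp add: card_image inj_on_subset)
  qed
  then have "(\<Sum>H\<in>h ` G. card {E \<in> S. h E = H}) =
      card (h ` G) * card {D \<in> dissections n. P (2 + card {a. (a, n - 1) \<in> D})}" by simp
  moreover have "(\<Sum>H\<in>h ` G. card {E \<in> S. h E = H}) = card S"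
    using sum.group[of S "h ` G" h "\<lambda>_. 1::nat"] fin by (auto simp: S_def)
  ultimately show ?thesis by (simp add: S_def G_def h_def)
qed

lemma degree_prob_dissections:
  assumes n: "3 \<le> n" and v: "v \<in> {1..n}"
  shows "degree_prob n v k =
    card {D \<in> dissections n. 2 + card {a. (a, n - 1) \<in> D} = k} / card (dissections n)"
proof -
  let ?G = "two_connected_outerplanar_graphs n"
  let ?h = "card (hamilton_edges {1..n} ` ?G)"
  have fin: "finite ?G"
    by (rule finite_subset[of _ "Pow (Pow {1..n})"])
      (auto simp: two_connected_outerplanar_graphs_def simple_graph_def)
  \<comment> \<open>The bare polygon shows that the uniform distribution is over a nonempty
    set.\<close>
  have "{} \<in> dissections n" by (auto simp: dissections_def noncrossing_def)
  then have "dissection_graph [1..<Suc n] {} \<in> ?G"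
    using n by (intro dissection_graph_outerplanar) auto
  then have ne: "?G \<noteq> {}" by blast
  have h: "?h \<noteq> 0" using fin ne by simp
  have "degree_prob n v k = card {E \<in> ?G. vertex_degree E v = k} / card ?G"
    using measure_pmf_of_set[OF ne fin] by (simp add: degree_prob_def Int_def)
  also have "card {E \<in> ?G. vertex_degree E v = k} =
      ?h * card {D \<in> dissections n. 2 + card {a. (a, n - 1) \<in> D} = k}"
    by (rule card_outerplanar_graphs_by_degree[OF n v])
  also have "card ?G = ?h * card (dissections n)"
    using card_outerplanar_graphs_by_degree[OF n v, of "\<lambda>_. True"] by simp
  finally show ?thesis using h by simp
qed

subsection \<open>Counting dissections\<close>

definition arcs :: "nat \<Rightarrow> nat \<Rightarrow> (nat \<times> nat) set" where
  "arcs l r = {(a, b). l \<le> a \<and> a + 2 \<le> b \<and> b \<le> r}"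

definition arc_systems :: "nat \<Rightarrow> nat \<Rightarrow> (nat \<times> nat) set set" where
  "arc_systems l r = {D. D \<subseteq> arcs l r \<and> noncrossing D}"

definition schroeder :: "nat \<Rightarrow> nat" where
  "schroeder d = card (arc_systems 0 d)"

text \<open>\<open>C\<close> stands for the positions joined to an additional vertex.\<close>

definition cut_arc_systems :: "nat \<Rightarrow> nat \<Rightarrow> (nat set \<times> (nat \<times> nat) set) set" where
  "cut_arc_systems r k = {(C, D). C \<subseteq> {0<..<r} \<and> card C = k \<and> D \<in> arc_systems 0 r \<and>
     (\<forall>(a, b)\<in>D. \<forall>c\<in>C. \<not> (a < c \<and> c < b))}"

definition schroeder_cut :: "nat \<Rightarrow> nat \<Rightarrow> nat" where
  "schroeder_cut r k = card (cut_arc_systems r k)"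

lemma noncrossing_subset: "noncrossing D \<Longrightarrow> D' \<subseteq> D \<Longrightarrow> noncrossing D'"
  unfolding noncrossing_def by blast

lemma finite_arcs [simp]: "finite (arcs l r)"
  by (rule finite_subset[of _ "{..r} \<times> {..r}"]) (auto simp: arcs_def)

lemma finite_arc_systems [simp]: "finite (arc_systems l r)"
  by (rule finite_subset[of _ "Pow (arcs l r)"]) (auto simp: arc_systems_def)

lemma finite_cut_arc_systems [simp]: "finite (cut_arc_systems r k)"
  by (rule finite_subset[of _ "Pow {0<..<r} \<times> arc_systems 0 r"]) (auto simp: cut_arc_systems_def)

lemma empty_arc_system [simp]: "{} \<in> arc_systems l r"
  by (auto simp: arc_systems_def noncrossing_def)

lemma schroeder_pos: "0 < schroeder d"
  using empty_arc_system[of 0 d] by (auto simp: schroeder_def card_gt_0_iff simp del: empty_arc_system)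

lemma schroeder_1: "schroeder 1 = 1"
proof -
  have "arcs 0 1 = {}" by (auto simp: arcs_def)
  then have "arc_systems 0 1 = {{}}" by (auto simp: arc_systems_def noncrossing_def)
  then show ?thesis by (simp add: schroeder_def)
qed

lemma card_arc_systems_shift: "card (arc_systems l (l + d)) = schroeder d"
proof -
  define f where "f = (\<lambda>(a, b). (a + l, b + l))"
  have inj: "inj f" by (auto simp: f_def inj_def)
  have nc: "noncrossing (f ` D) \<longleftrightarrow> noncrossing D" for D
    by (simp add: noncrossing_def f_def split_beta)
  have arcs: "f ` D \<subseteq> arcs l (l + d) \<longleftrightarrow> D \<subseteq> arcs 0 d" for D
  proof -
    have "f x \<in> arcs l (l + d) \<longleftrightarrow> x \<in> arcs 0 d" for x by (cases x) (auto simp: f_def arcs_def)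
    then show ?thesis by blast
  qed
  have "arc_systems l (l + d) = (`) f ` arc_systems 0 d"
  proof
    show "(`) f ` arc_systems 0 d \<subseteq> arc_systems l (l + d)"
      using nc arcs by (auto simp: arc_systems_def)
    show "arc_systems l (l + d) \<subseteq> (`) f ` arc_systems 0 d"
    proof
      fix D assume D: "D \<in> arc_systems l (l + d)"
      have "arcs l (l + d) \<subseteq> range f"
      proof (rule subrelI)
        fix a b assume "(a, b) \<in> arcs l (l + d)"
        then have "(a, b) = f (a - l, b - l)" by (auto simp: arcs_def f_def)
        then show "(a, b) \<in> range f" by blast
      qed
      then have "D \<subseteq> range f" using D unfolding arc_systems_def by blast
      then have "D = f ` (f -` D)" by blast
      moreover from this have "f -` D \<in> arc_systems 0 d"
        using D nc[of "f -` D"] arcs[of "f -` D"] by (simp add: arc_systems_def)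
      ultimately show "D \<in> (`) f ` arc_systems 0 d" by blast
    qed
  qed
  then show ?thesis
    unfolding schroeder_def using inj by (simp add: card_image inj_on_def inj_image_eq_iff)
qed

lemma schroeder_cut_0: "schroeder_cut r 0 = schroeder r"
proof -
  have "cut_arc_systems r 0 = Pair {} ` arc_systems 0 r"
    by (auto simp: cut_arc_systems_def dest: finite_subset[OF _ finite_greaterThanLessThan])
  then show ?thesis
    by (simp add: schroeder_cut_def schroeder_def card_image inj_on_def)
qed

text \<open>The largest cut point separates the system into two independent parts.\<close>

lemma schroeder_cut_Suc:
  "schroeder_cut r (Suc k) = (\<Sum>i\<in>{0<..<r}. schroeder_cut i k * schroeder (r - i))"
proof -
  define A where "A = Sigma {0<..<r} (\<lambda>i. cut_arc_systems i k \<times> arc_systems i r)"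
  define f where "f = (\<lambda>(i::nat, (C, D), D'). (insert i C, D \<union> D' :: (nat \<times> nat) set))"
  define g where "g = (\<lambda>(C, D). (Max C, (C - {Max C}, D \<inter> arcs 0 (Max C)), D \<inter> arcs (Max C) r))"
  have "bij_betw f A (cut_arc_systems r (Suc k))"
  proof (rule bij_betw_byWitness[where f' = g])
    show "\<forall>x\<in>A. g (f x) = x"
    proof
      fix x assume "x \<in> A"
      then obtain i C D D' where x: "x = (i, (C, D), D')" "0 < i" "i < r" "C \<subseteq> {0<..<i}"
        "D \<subseteq> arcs 0 i" "D' \<subseteq> arcs i r"
        by (auto simp: A_def cut_arc_systems_def arc_systems_def)
      have "finite C" using x(4) finite_subset by blast
      then have "Max (insert i C) = i" using x(4) by (intro Max_eqI) auto
      moreover have "i \<notin> C" using x(4) by auto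
      moreover have "(D \<union> D') \<inter> arcs 0 i = D" "(D \<union> D') \<inter> arcs i r = D'"
        using x(3,5,6) by (fastforce simp: arcs_def)+
      ultimately show "g (f x) = x" by (simp add: x(1) f_def g_def)
    qed
    have cut: "Max C \<in> C" "Max C \<in> {0<..<r}" "finite C" "C - {Max C} \<subseteq> {0<..<Max C}" "card (C - {Max C}) = k"
      "D = D \<inter> arcs 0 (Max C) \<union> D \<inter> arcs (Max C) r"
      if CD: "(C, D) \<in> cut_arc_systems r (Suc k)" for C D
    proof -
      have C: "C \<subseteq> {0<..<r}" "card C = Suc k" "D \<subseteq> arcs 0 r" and sep: "\<forall>(a, b)\<in>D. \<forall>c\<in>C. \<not> (a < c \<and> c < b)"
        using CD by (auto simp: cut_arc_systems_def arc_systems_def)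
      show fin: "finite C" using C(2) by (metis card.infinite nat.distinct(1))
      have ne: "C \<noteq> {}" using C(2) by auto
      show max: "Max C \<in> C" using fin ne by (rule Max_in)
      then show "Max C \<in> {0<..<r}" using C(1) by blast
      show "C - {Max C} \<subseteq> {0<..<Max C}"
      proof
        fix c assume c: "c \<in> C - {Max C}"
        then have "c \<le> Max C" using fin by auto
        then show "c \<in> {0<..<Max C}" using c C(1) by auto
      qed
      show "card (C - {Max C}) = k" using C(2) max fin by simp
      show "D = D \<inter> arcs 0 (Max C) \<union> D \<inter> arcs (Max C) r"
        using C(3) sep max by (fastforce simp: arcs_def)
    qed
    show "\<forall>y\<in>cut_arc_systems r (Suc k). f (g y) = y"
    proof
      fix y assume y: "y \<in> cut_arc_systems r (Suc k)"
      obtain C D where CD: "y = (C, D)" by (cases y)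
      show "f (g y) = y"
        using cut(1,6)[of C D] y by (simp add: CD f_def g_def insert_absorb)
    qed
    show "f ` A \<subseteq> cut_arc_systems r (Suc k)"
    proof (rule image_subsetI)
      fix x assume "x \<in> A"
      then obtain i C D D' where x: "x = (i, (C, D), D')" "0 < i" "i < r" "C \<subseteq> {0<..<i}"
        "card C = k" "D \<subseteq> arcs 0 i" "noncrossing D" "D' \<subseteq> arcs i r" "noncrossing D'"
        and sep: "\<forall>(a, b)\<in>D. \<forall>c\<in>C. \<not> (a < c \<and> c < b)"
        by (auto simp: A_def cut_arc_systems_def arc_systems_def)
      have fin: "finite C" using x(4) finite_subset by blast
      have D: "b \<le> i" if "(a, b) \<in> D" for a b using that x(6) by (auto simp: arcs_def)
      have D': "i \<le> a" if "(a, b) \<in> D'" for a b using that x(8) by (auto simp: arcs_def)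
      have "card (insert i C) = Suc k" using x(4,5) fin by (subst card_insert_disjoint) auto
      moreover have "insert i C \<subseteq> {0<..<r}" using x(2-4) by auto
      moreover have "D \<union> D' \<subseteq> arcs 0 r" using x(3,6,8) by (fastforce simp: arcs_def)
      moreover have "noncrossing (D \<union> D')"
        unfolding noncrossing_def
      proof (clarify)
        fix a b c d assume *: "(a, b) \<in> D \<union> D'" "(c, d) \<in> D \<union> D'" "a < c" "c < b" "b < d"
        show False
          using * D[of a b] D[of c d] D'[of a b] D'[of c d] noncrossingD[OF x(7)] noncrossingD[OF x(9)]
          by (auto; fastforce)
      qed
      moreover have "\<not> (a < c \<and> c < b)" if "(a, b) \<in> D \<union> D'" "c \<in> insert i C" for a b c
        using that D[of a b] D'[of a b] sep x(4) by fastforce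
      ultimately show "f x \<in> cut_arc_systems r (Suc k)"
        by (auto simp: x(1) f_def cut_arc_systems_def arc_systems_def)
    qed
    show "g ` cut_arc_systems r (Suc k) \<subseteq> A"
    proof (rule image_subsetI)
      fix y assume y: "y \<in> cut_arc_systems r (Suc k)"
      obtain C D where CD: "y = (C, D)" by (cases y)
      note c = cut[OF y[unfolded CD]]
      have nc: "noncrossing D" and sep: "\<forall>(a, b)\<in>D. \<forall>c\<in>C. \<not> (a < c \<and> c < b)"
        using y by (auto simp: CD cut_arc_systems_def arc_systems_def)
      show "g y \<in> A"
        using c(2,4,5) sep noncrossing_subset[OF nc]
        by (auto simp: CD g_def A_def cut_arc_systems_def arc_systems_def)
    qed
  qed
  then have "schroeder_cut r (Suc k) = card A"
    using bij_betw_same_card by (fastforce simp: schroeder_cut_def)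
  also have "\<dots> = (\<Sum>i\<in>{0<..<r}. card (cut_arc_systems i k \<times> arc_systems i r))"
    unfolding A_def by (rule card_SigmaI) auto
  also have "\<dots> = (\<Sum>i\<in>{0<..<r}. schroeder_cut i k * schroeder (r - i))"
  proof (rule sum.cong)
    fix i assume "i \<in> {0<..<r}"
    then show "card (cut_arc_systems i k \<times> arc_systems i r) = schroeder_cut i k * schroeder (r - i)"
      using card_arc_systems_shift[of i "r - i"] by (simp add: schroeder_cut_def card_cartesian_product)
  qed simp
  finally show ?thesis .
qed

lemma finite_dissections [simp]: "finite (dissections n)"
proof -
  have "dissections n \<subseteq> Pow ({..n} \<times> {..n})" by (auto simp: dissections_def)
  then show ?thesis by (rule finite_subset) simp
qed

text \<open>The neighbours of the last vertex of a dissected polygon are the cut points of the rest.\<close>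

lemma card_dissections_by_degree:
  assumes "1 \<le> r"
  shows "card {D \<in> dissections (r + 2). card {a. (a, r + 1) \<in> D} = k} = schroeder_cut r k"
proof -
  define f where "f = (\<lambda>D. ({a. (a, r + 1) \<in> D}, D \<inter> arcs 0 r))"
  define g where "g = (\<lambda>(C, D). D \<union> (\<lambda>c. (c, r + 1)) ` C :: (nat \<times> nat) set)"
  have "bij_betw f {D \<in> dissections (r + 2). card {a. (a, r + 1) \<in> D} = k} (cut_arc_systems r k)"
  proof (rule bij_betw_byWitness[where f' = g])
    show "\<forall>D\<in>{D \<in> dissections (r + 2). card {a. (a, r + 1) \<in> D} = k}. g (f D) = D"
    proof
      fix D assume D: "D \<in> {D \<in> dissections (r + 2). card {a. (a, r + 1) \<in> D} = k}"
      have "x \<in> g (f D)" if "x \<in> D" for x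
      proof -
        obtain a b where x: "x = (a, b)" by (cases x)
        have "a + 2 \<le> b" "b < r + 2" using D that by (auto simp: dissections_def x)
        then show ?thesis using that by (cases "b = r + 1") (auto simp: x f_def g_def arcs_def)
      qed
      then show "g (f D) = D" by (auto simp: f_def g_def)
    qed
    show "\<forall>y\<in>cut_arc_systems r k. f (g y) = y"
    proof
      fix y assume y: "y \<in> cut_arc_systems r k"
      obtain C D where CD: "y = (C, D)" by (cases y)
      have "D \<subseteq> arcs 0 r" using y by (auto simp: CD cut_arc_systems_def arc_systems_def)
      then show "f (g y) = y" by (auto simp: CD f_def g_def arcs_def)
    qed
    show "f ` {D \<in> dissections (r + 2). card {a. (a, r + 1) \<in> D} = k} \<subseteq> cut_arc_systems r k"
    proof (rule image_subsetI)
      fix D assume D: "D \<in> {D \<in> dissections (r + 2). card {a. (a, r + 1) \<in> D} = k}"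
      then have sub: "\<And>a b. (a, b) \<in> D \<Longrightarrow> a + 2 \<le> b \<and> b < r + 2 \<and> (a, b) \<noteq> (0, r + 1)"
        and nc: "noncrossing D" by (auto simp: dissections_def)
      have "{a. (a, r + 1) \<in> D} \<subseteq> {0<..<r}"
      proof
        fix a assume "a \<in> {a. (a, r + 1) \<in> D}"
        then show "a \<in> {0<..<r}" using sub[of a "r + 1"] by auto
      qed
      moreover have "\<not> (a < c \<and> c < b)" if "(a, b) \<in> D \<inter> arcs 0 r" "(c, r + 1) \<in> D" for a b c
        using noncrossingD[OF nc _ that(2), of a b] that(1) by (auto simp: arcs_def)
      ultimately show "f D \<in> cut_arc_systems r k"
        using D noncrossing_subset[OF nc, of "D \<inter> arcs 0 r"]
        by (auto simp: f_def cut_arc_systems_def arc_systems_def)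
    qed
    show "g ` cut_arc_systems r k \<subseteq> {D \<in> dissections (r + 2). card {a. (a, r + 1) \<in> D} = k}"
    proof (rule image_subsetI)
      fix y assume y: "y \<in> cut_arc_systems r k"
      obtain C D where CD: "y = (C, D)" by (cases y)
      have C: "C \<subseteq> {0<..<r}" "card C = k" and D: "D \<subseteq> arcs 0 r" "noncrossing D"
        and sep: "\<And>a b c. (a, b) \<in> D \<Longrightarrow> c \<in> C \<Longrightarrow> a < c \<Longrightarrow> c < b \<Longrightarrow> False"
        using y by (auto simp: CD cut_arc_systems_def arc_systems_def)
      have Db: "a + 2 \<le> b \<and> b \<le> r" if "(a, b) \<in> D" for a b using that D(1) by (auto simp: arcs_def)
      have "{a. (a, r + 1) \<in> g y} = C" using Db by (fastforce simp: CD g_def)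
      moreover have "noncrossing (g y)"
        unfolding noncrossing_def
      proof (clarify)
        fix a b c d assume *: "(a, b) \<in> g y" "(c, d) \<in> g y" "a < c" "c < b" "b < d"
        have "b \<le> r" "(a, b) \<in> D" using * Db[of c d] by (auto simp: CD g_def)
        then show False
          using * noncrossingD[OF D(2), of a b c d] sep[of a b c] by (auto simp: CD g_def)
      qed
      moreover have "a + 2 \<le> b \<and> b < r + 2 \<and> (a, b) \<noteq> (0, r + 1)" if "(a, b) \<in> g y" for a b
        using that Db[of a b] C(1) by (auto simp: CD g_def)
      ultimately show "g y \<in> {D \<in> dissections (r + 2). card {a. (a, r + 1) \<in> D} = k}"
        using C(2) by (auto simp: dissections_def)
    qed
  qed
  then show ?thesis unfolding schroeder_cut_def by (rule bij_betw_same_card)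
qed

text \<open>The last vertex has at most \<open>r - 1\<close> chords, so any \<open>m\<close> from
  \<open>r\<close> on exhausts the cases. The freedom in \<open>m\<close> provides one bound for
  many sizes, which allows sums to be interchanged later.\<close>

lemma card_dissections_sum:
  assumes "1 \<le> r" "r \<le> m"
  shows "card (dissections (r + 2)) = (\<Sum>k<m. schroeder_cut r k)"
proof -
  let ?deg = "\<lambda>D. card {a. (a, r + 1) \<in> (D :: (nat \<times> nat) set)}"
  have "?deg D < m" if D: "D \<in> dissections (r + 2)" for D
  proof -
    have "{a. (a, r + 1) \<in> D} \<subseteq> {0<..<r}"
    proof
      fix a assume "a \<in> {a. (a, r + 1) \<in> D}"
      then have "(a, r + 1) \<in> D" by simp
      then have "a + 2 \<le> r + 1 \<and> (a, r + 1) \<noteq> (0, r + 1)"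
        using D unfolding dissections_def by fastforce
      then show "a \<in> {0<..<r}" by auto
    qed
    then have "?deg D \<le> card {0<..<r}" by (rule card_mono[rotated]) simp
    then show ?thesis using assms by simp
  qed
  then have "(\<Sum>k<m. card {D \<in> dissections (r + 2). ?deg D = k}) = card (dissections (r + 2))"
    using sum.group[of "dissections (r + 2)" "{..<m}" ?deg "\<lambda>_. 1::nat"] by auto
  then show ?thesis using card_dissections_by_degree[OF assms(1)] by simp
qed

text \<open>The factor 2 accounts for the presence of the outer arc.\<close>

lemma schroeder_Suc_dissections:
  assumes "1 \<le> r"
  shows "schroeder (r + 1) = 2 * card (dissections (r + 2))"
proof -
  let ?o = "(0::nat, r + 1)"
  have out: "?o \<notin> D" if "D \<in> dissections (r + 2)" for D using that by (auto simp: dissections_def)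
  have eq: "arc_systems 0 (r + 1) = dissections (r + 2) \<union> insert ?o ` dissections (r + 2)"
  proof
    show "arc_systems 0 (r + 1) \<subseteq> dissections (r + 2) \<union> insert ?o ` dissections (r + 2)"
    proof
      fix D assume D: "D \<in> arc_systems 0 (r + 1)"
      then have "D - {?o} \<in> dissections (r + 2)"
        using noncrossing_subset[of D "D - {?o}"]
        by (auto simp: arc_systems_def dissections_def arcs_def)
      then show "D \<in> dissections (r + 2) \<union> insert ?o ` dissections (r + 2)"
        by (cases "?o \<in> D") (auto simp: image_iff intro!: bexI[of _ "D - {?o}"])
    qed
    have "insert ?o D \<in> arc_systems 0 (r + 1)" "D \<in> arc_systems 0 (r + 1)" if "D \<in> dissections (r + 2)" for D
    proof -
      have D: "\<And>a b. (a, b) \<in> D \<Longrightarrow> a + 2 \<le> b \<and> b < r + 2" "noncrossing D"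
        using that by (auto simp: dissections_def)
      have "noncrossing (insert ?o D)"
        unfolding noncrossing_def
      proof (clarify)
        fix a b c d assume *: "(a, b) \<in> insert ?o D" "(c, d) \<in> insert ?o D" "a < c" "c < b" "b < d"
        show False
          using * noncrossingD[OF D(2), of a b c d] D(1)[of a b] D(1)[of c d] by auto
      qed
      then show "insert ?o D \<in> arc_systems 0 (r + 1)" "D \<in> arc_systems 0 (r + 1)"
        using D assms by (fastforce simp: arc_systems_def arcs_def)+
    qed
    then show "dissections (r + 2) \<union> insert ?o ` dissections (r + 2) \<subseteq> arc_systems 0 (r + 1)" by blast
  qed
  have "card (insert ?o ` dissections (r + 2)) = card (dissections (r + 2))"
    using out by (intro card_image inj_onI) (metis insert_ident)
  moreover have "dissections (r + 2) \<inter> insert ?o ` dissections (r + 2) = {}" using out by blast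
  ultimately show ?thesis
    unfolding schroeder_def eq by (simp add: card_Un_disjoint)
qed

section \<open>The generating function of the large Schroeder numbers\<close>

definition schroeder_fps :: "real fps" where
  "schroeder_fps = Abs_fps (\<lambda>d. if d = 0 then 0 else real (schroeder d))"

text \<open>The \<open>k\<close> cut points leave \<open>k + 1\<close> pieces, each of length at
  least 1. For this the constant term of the series is 0, although \<open>schroeder 0\<close> is
  1.\<close>

lemma schroeder_cut_fps:
  "r \<ge> 1 \<Longrightarrow> fps_nth (schroeder_fps ^ Suc k) r = real (schroeder_cut r k)"
proof (induction k arbitrary: r)
  case 0
  then show ?case by (simp add: schroeder_fps_def schroeder_cut_0)
next
  case (Suc k)
  have zero: "fps_nth (schroeder_fps ^ Suc k) 0 = 0" by (simp add: schroeder_fps_def fps_nth_power_0)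
  have "fps_nth (schroeder_fps ^ Suc (Suc k)) r = fps_nth (schroeder_fps ^ Suc k * schroeder_fps) r"
    by (simp add: mult.commute)
  also have "\<dots> = (\<Sum>i=0..r. fps_nth (schroeder_fps ^ Suc k) i * fps_nth schroeder_fps (r - i))"
    by (rule fps_mult_nth)
  also have "\<dots> = (\<Sum>i\<in>{0<..<r}. fps_nth (schroeder_fps ^ Suc k) i * fps_nth schroeder_fps (r - i))"
  proof (rule sum.mono_neutral_right)
    show "\<forall>i\<in>{0..r} - {0<..<r}. fps_nth (schroeder_fps ^ Suc k) i * fps_nth schroeder_fps (r - i) = 0"
    proof
      fix i assume "i \<in> {0..r} - {0<..<r}"
      then have "i = 0 \<or> i = r" by auto
      then show "fps_nth (schroeder_fps ^ Suc k) i * fps_nth schroeder_fps (r - i) = 0"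
        using zero by (auto simp del: power_Suc simp: schroeder_fps_def)
    qed
  qed auto
  also have "\<dots> = (\<Sum>i\<in>{0<..<r}. real (schroeder_cut i k * schroeder (r - i)))"
    using Suc.IH by (intro sum.cong) (auto simp del: power_Suc simp: schroeder_fps_def)
  also have "\<dots> = real (schroeder_cut r (Suc k))"
    unfolding schroeder_cut_Suc by simp
  finally show ?case .
qed

text \<open>Let \<open>G\<close> count dissections. Summing over the number of cut points gives G =
  S + G S, a geometric series in S, and the optional outer arc gives S = x + 2 x G; eliminating
  \<open>G\<close> yields the equation.\<close>

lemma schroeder_fps_equation:
  "schroeder_fps = fps_X + fps_X * schroeder_fps + schroeder_fps\<^sup>2"
proof -
  let ?S = schroeder_fps
  define G :: "real fps" where
    "G = Abs_fps (\<lambda>r. if r = 0 then 0 else real (card (dissections (r + 2))))"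
  have G: "G = ?S + G * ?S"
  proof (rule fps_ext)
    fix r
    show "fps_nth G r = fps_nth (?S + G * ?S) r"
    proof (cases "r = 0")
      case True
      then show ?thesis by (simp add: G_def schroeder_fps_def)
    next
      case False
      \<comment> \<open>The bound is \<open>Suc r\<close> so that after peeling off
        \<open>k = 0\<close> exactly \<open>r\<close> terms remain, a bound that also covers every
        smaller size.\<close>
      have "card (dissections (r + 2)) = (\<Sum>k<Suc r. schroeder_cut r k)"
        using False by (intro card_dissections_sum) auto
      also have "\<dots> = schroeder_cut r 0 + (\<Sum>k<r. schroeder_cut r (Suc k))"
        by (rule sum.lessThan_Suc_shift)
      also have "(\<Sum>k<r. schroeder_cut r (Suc k)) =
          (\<Sum>i\<in>{0<..<r}. \<Sum>k<r. schroeder_cut i k * schroeder (r - i))"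
        unfolding schroeder_cut_Suc by (rule sum.swap)
      also have "\<dots> = (\<Sum>i\<in>{0<..<r}. card (dissections (i + 2)) * schroeder (r - i))"
      proof (rule sum.cong)
        fix i assume "i \<in> {0<..<r}"
        then have "card (dissections (i + 2)) = (\<Sum>k<r. schroeder_cut i k)"
          by (intro card_dissections_sum) auto
        then show "(\<Sum>k<r. schroeder_cut i k * schroeder (r - i)) =
            card (dissections (i + 2)) * schroeder (r - i)"
          by (simp only: sum_distrib_right)
      qed simp
      finally have "fps_nth G r = fps_nth ?S r + (\<Sum>i\<in>{0<..<r}. fps_nth G i * fps_nth ?S (r - i))"
        using False by (simp add: G_def schroeder_fps_def schroeder_cut_0)
      also have "(\<Sum>i\<in>{0<..<r}. fps_nth G i * fps_nth ?S (r - i)) = (\<Sum>i=0..r. fps_nth G i * fps_nth ?S (r - i))"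
      proof (rule sum.mono_neutral_left)
        show "\<forall>i\<in>{0..r} - {0<..<r}. fps_nth G i * fps_nth ?S (r - i) = 0"
          by (auto simp: G_def schroeder_fps_def)
      qed auto
      finally show ?thesis by (simp add: fps_mult_nth)
    qed
  qed
  have S: "?S = fps_X + 2 * (fps_X * G)"
  proof (rule fps_ext)
    fix r
    show "fps_nth ?S r = fps_nth (fps_X + 2 * (fps_X * G)) r"
    proof (cases r)
      case (Suc m)
      then show ?thesis
        using schroeder_1 schroeder_Suc_dissections[of m]
        by (cases m) (simp_all add: schroeder_fps_def G_def numeral_fps_const)
    qed (simp add: schroeder_fps_def numeral_fps_const)
  qed
  have "(?S - fps_X) * (1 - ?S) = 2 * fps_X * (G - G * ?S)"
    by (subst S) (simp add: algebra_simps)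
  also have "G - G * ?S = ?S" using G by (simp add: algebra_simps)
  finally show ?thesis by (simp add: algebra_simps power2_eq_square)
qed

subsection \<open>Asymptotics\<close>

abbreviation schr :: "nat \<Rightarrow> real" where
  "schr n \<equiv> fps_nth schroeder_fps n"

lemma schr_pos: "1 \<le> n \<Longrightarrow> 0 < schr n"
  using schroeder_pos[of n] by (simp add: schroeder_fps_def)

text \<open>
  The series \<open>Q = 1 - x - 2 S\<close> satisfies \<open>Q\<^sup>2 = 1 - 6 x + x\<^sup>2\<close>; comparing coefficients in
  \<open>(1 - 6 x + x\<^sup>2) Q' = (x - 3) Q\<close> gives the recurrence.
\<close>

lemma schr_recurrence:
  assumes "2 \<le> n"
  shows "real (n + 1) * schr (n + 1) = (6 * real n - 3) * schr n - (real n - 2) * schr (n - 1)"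
proof -
  let ?S = schroeder_fps and ?X = "fps_X :: real fps"
  define Q where "Q = 1 - ?X - 2 * ?S"
  define P where "P = 1 - 6 * ?X + ?X\<^sup>2"
  have "Q\<^sup>2 = (1 - ?X)\<^sup>2 - 4 * (?S - ?X * ?S - ?S\<^sup>2)"
    by (simp add: Q_def algebra_simps power2_eq_square)
  also have "?S - ?X * ?S - ?S\<^sup>2 = ?X"
    using schroeder_fps_equation by (simp add: algebra_simps)
  finally have Q2: "Q\<^sup>2 = P" by (simp add: P_def algebra_simps power2_eq_square)
  have "fps_deriv (Q\<^sup>2) = fps_deriv P" by (simp only: Q2)
  then have "2 * (Q * fps_deriv Q) = 2 * (?X - 3)"
    by (simp add: P_def power2_eq_square algebra_simps)
  then have "(2 :: real fps) = 0 \<or> Q * fps_deriv Q = ?X - 3" by (simp only: mult_cancel_left)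
  then have "Q * fps_deriv Q = ?X - 3" by simp
  then have "Q * (Q * fps_deriv Q) = Q * (?X - 3)" by simp
  then have ode: "P * fps_deriv Q = (?X - 3) * Q"
    by (simp add: Q2[symmetric] power2_eq_square algebra_simps)
  have "n = Suc (Suc (n - 2))" using assms by simp
  then obtain m where m: "n = Suc (Suc m)" by blast
  have q: "fps_nth Q i = (if i = 0 then 1 else if i = 1 then -1 else 0) - 2 * schr i" for i
    by (simp add: Q_def numeral_fps_const)
  have L: "fps_nth (P * fps_deriv Q) n =
      real (n + 1) * fps_nth Q (n + 1) - 6 * (real n * fps_nth Q n) + real (n - 1) * fps_nth Q (n - 1)"
  proof -
    have "P * fps_deriv Q = fps_deriv Q - 6 * (?X * fps_deriv Q) + ?X * (?X * fps_deriv Q)"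
      by (simp add: P_def algebra_simps power2_eq_square)
    then show ?thesis by (simp add: m numeral_fps_const)
  qed
  have R: "fps_nth ((?X - 3) * Q) n = fps_nth Q (n - 1) - 3 * fps_nth Q n"
    by (simp add: m left_diff_distrib numeral_fps_const)
  have "real (n + 1) * fps_nth Q (n + 1) - 6 * (real n * fps_nth Q n) + real (n - 1) * fps_nth Q (n - 1) =
      fps_nth Q (n - 1) - 3 * fps_nth Q n"
    using L R ode by simp
  then show ?thesis
    \<comment> \<open>For \<open>n = 2\<close> the extra -1 in the linear coefficient of
      \<open>Q\<close> is multiplied by n - 2 = 0.\<close>
    by (cases m) (simp_all add: m q algebra_simps)
qed

text \<open>A crude bound, with equality at \<open>n = 2\<close>. Its use is to make the contraction
  factor 1 / (r R) at most 1/9.\<close>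

lemma schr_ratio_ge_3: "2 \<le> n \<Longrightarrow> 3 \<le> schr (Suc n) / schr n"
proof (induction n rule: dec_induct)
  case base
  have "3 * schr 3 = 9 * schr 2" using schr_recurrence[of 2] by (simp add: numeral_eq_Suc)
  then show ?case using schr_pos[of 2] by (simp add: numeral_eq_Suc)
next
  case (step n)
  have pos: "0 < schr n" "0 < schr (Suc n)" using step(1) by (auto intro: schr_pos)
  have "3 * schr n \<le> schr (Suc n)" using step.IH pos by (simp add: field_simps)
  then have "(real n - 1) * (3 * schr n) \<le> (real n - 1) * schr (Suc n)"
    using step(1) by (intro mult_left_mono) auto
  moreover have "real (n + 2) * schr (n + 2) = (6 * real n + 3) * schr (n + 1) - (real n - 1) * schr n"
    using schr_recurrence[of "n + 1"] step(1) by (simp add: algebra_simps)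
  ultimately have "3 * (real (n + 2) * schr (n + 2)) \<ge> 3 * (6 * real n + 3) * schr (n + 1) - (real n - 1) * schr (n + 1)"
    by (simp add: algebra_simps)
  also have "3 * (6 * real n + 3) * schr (n + 1) - (real n - 1) * schr (n + 1) = (17 * real n + 10) * schr (n + 1)"
    by (simp add: algebra_simps)
  finally have "(17 * real n + 10) * schr (n + 1) \<le> 3 * (real (n + 2) * schr (n + 2))" .
  \<comment> \<open>This amounts to 9 (n + 2) being at most 17 n + 10, true from n = 1 on.\<close>
  moreover have "9 * real (n + 2) * schr (n + 1) \<le> (17 * real n + 10) * schr (n + 1)"
    using step(1) pos by (intro mult_right_mono) auto
  ultimately have "real (n + 2) * (3 * schr (n + 1)) \<le> real (n + 2) * schr (n + 2)" by linarith
  then have "3 * schr (n + 1) \<le> schr (n + 2)" by (rule mult_left_le_imp_le) simp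
  then show ?case using pos by (simp add: field_simps)
qed

text \<open>The recurrence for the ratios contracts towards the fixed point \<open>R = 6 - 1 / R\<close>.\<close>

lemma schr_ratio_bound:
  "2 \<le> n \<Longrightarrow> \<bar>schr (Suc n) / schr n - (3 + 2 * sqrt 2)\<bar> \<le> 30 / (real n + 1)"
proof (induction n rule: dec_induct)
  case base
  have "3 * schr 3 = 9 * schr 2" using schr_recurrence[of 2] by (simp add: numeral_eq_Suc)
  then have "schr (Suc 2) / schr 2 = 3" using schr_pos[of 2] by (simp add: numeral_eq_Suc)
  moreover have "sqrt 2 \<le> 2" by (rule real_le_lsqrt) auto
  ultimately show ?case by simp
next
  case (step n)
  define R where "R = 3 + 2 * sqrt 2"
  define r where "r = schr (Suc n) / schr n"
  define r' where "r' = schr (Suc (Suc n)) / schr (Suc n)"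
  have pos: "0 < schr n" "0 < schr (Suc n)" using step(1) by (auto intro: schr_pos)
  have "R * (6 - R) = 1" by (simp add: R_def algebra_simps)
  moreover have R3: "3 \<le> R" by (simp add: R_def)
  ultimately have R: "6 = R + 1 / R" by (simp add: field_simps)
  have r3: "3 \<le> r" unfolding r_def by (rule schr_ratio_ge_3) (use step in auto)
  have rec: "real (n + 2) * schr (n + 2) = (6 * real n + 3) * schr (n + 1) - (real n - 1) * schr n"
    using schr_recurrence[of "n + 1"] step(1) by (simp add: algebra_simps)
  have "(real n + 2) * r' = (6 * real n + 3) - (real n - 1) * (1 / r)"
  proof -
    have "(real n + 2) * r' = (real (n + 2) * schr (n + 2)) / schr (n + 1)" by (simp add: r'_def)
    also have "\<dots> = (6 * real n + 3) - (real n - 1) * (1 / r)"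
      unfolding rec r_def using pos by (simp add: diff_divide_distrib)
    finally show ?thesis .
  qed
  \<comment> \<open>Rewrite 6 n + 3 as 6 (n + 2) - 9 and n - 1 as (n + 2) - 3, then subtract the
    fixed point equation R = 6 - 1 / R times n + 2.\<close>
  then have "(real n + 2) * (r' - R) = - 9 + 3 / r - (real n + 2) * (1 / r - 1 / R)"
    using R by (simp add: algebra_simps)
  also have "1 / r - 1 / R = (R - r) / (r * R)"
    using r3 R3 by (simp add: diff_divide_distrib)
  finally have eq: "(real n + 2) * (r' - R) = - 9 + 3 / r - (real n + 2) * ((R - r) / (r * R))" .
  have triangle: "\<bar>x - y\<bar> \<le> 9 + \<bar>y\<bar>" if "\<bar>x\<bar> \<le> 9" for x y :: real using that by linarith
  have "0 \<le> 3 / r" "3 / r \<le> 1" using r3 by auto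
  then have "\<bar>- 9 + 3 / r\<bar> \<le> 9" by linarith
  then have "\<bar>(real n + 2) * (r' - R)\<bar> \<le> 9 + \<bar>(real n + 2) * ((R - r) / (r * R))\<bar>"
    unfolding eq by (rule triangle)
  then have bound: "(real n + 2) * \<bar>r' - R\<bar> \<le> 9 + (real n + 2) * \<bar>(R - r) / (r * R)\<bar>"
    by (simp only: abs_mult)
  have "9 \<le> r * R" using mult_mono[OF r3 R3] r3 by simp
  then have "\<bar>(R - r) / (r * R)\<bar> = \<bar>R - r\<bar> / (r * R)" by (simp add: abs_divide)
  also have "\<dots> \<le> \<bar>R - r\<bar> / 9"
    using \<open>9 \<le> r * R\<close> by (intro divide_left_mono) auto
  also have "\<dots> \<le> 30 / (real n + 1) / 9"
  proof (rule divide_right_mono)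
    show "\<bar>R - r\<bar> \<le> 30 / (real n + 1)"
      using step.IH unfolding r_def[symmetric] R_def[symmetric] by linarith
  qed simp
  finally have "\<bar>(R - r) / (r * R)\<bar> \<le> 30 / (real n + 1) / 9" .
  then have "(real n + 2) * \<bar>(R - r) / (r * R)\<bar> \<le> (real n + 2) * (30 / (real n + 1) / 9)"
    by (intro mult_left_mono) auto
  \<comment> \<open>For n at least 2 the left side is at most 40/9. The bound 21 is generous: it is
    what is left of 30 after the perturbation 9.\<close>
  also have "\<dots> \<le> 21"
    using step(1) by (simp add: field_simps)
  finally have "(real n + 2) * \<bar>r' - R\<bar> \<le> 30" using bound by linarith
  then have "\<bar>r' - R\<bar> \<le> 30 / (real n + 2)" by (simp add: pos_le_divide_eq mult.commute)
  then show ?case unfolding r'_def R_def by (simp add: add.commute)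
qed

lemma schr_ratio_limit: "(\<lambda>n. schr n / schr (Suc n)) \<longlonglongrightarrow> 3 - 2 * sqrt 2"
proof -
  have "(\<lambda>n. schr (Suc n) / schr n - (3 + 2 * sqrt 2)) \<longlonglongrightarrow> 0"
  proof (rule Lim_null_comparison)
    show "\<forall>\<^sub>F n in sequentially. norm (schr (Suc n) / schr n - (3 + 2 * sqrt 2)) \<le> 30 / (real n + 1)"
      using eventually_ge_at_top[of 2] by eventually_elim (use schr_ratio_bound in auto)
    show "(\<lambda>n. 30 / (real n + 1)) \<longlonglongrightarrow> 0" by real_asymp
  qed
  then have "(\<lambda>n. schr (Suc n) / schr n) \<longlonglongrightarrow> 3 + 2 * sqrt 2"
    by (simp add: LIM_zero_iff)
  then have "(\<lambda>n. inverse (schr (Suc n) / schr n)) \<longlonglongrightarrow> inverse (3 + 2 * sqrt 2)"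
    by (rule tendsto_inverse) (smt (verit) real_sqrt_ge_zero)
  moreover have "inverse (3 + 2 * sqrt 2) = 3 - 2 * sqrt 2"
    by (rule inverse_unique) (simp add: algebra_simps)
  ultimately show ?thesis by simp
qed

section \<open>Coefficients of the powers of S, and the limit of the degree probabilities\<close>

lemma double_root_recurrence:
  fixes l :: real
  assumes "l\<^sup>2 = 1 - 2 * l"
  shows "real (Suc j) * l ^ (Suc j + 1) -
      (real (Suc j) * l ^ (Suc j + 1) + real j * l ^ (j + 1)) * l\<^sup>2 =
    real (Suc (Suc j)) * l ^ (Suc (Suc j) + 1)"
proof -
  \<comment> \<open>The factor 1 - 2 l - l^2 vanishes by assumption; that it is the only obstruction
    reflects the double root at \<open>l\<close>.\<close>
  have "real (Suc j) * l ^ (Suc j + 1) -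
      (real (Suc j) * l ^ (Suc j + 1) + real j * l ^ (j + 1)) * l\<^sup>2 -
      real (Suc (Suc j)) * l ^ (Suc (Suc j) + 1) =
    l ^ (j + 2) * ((real j + 1) * (1 - 2 * l - l\<^sup>2))"
    by (simp add: algebra_simps power2_eq_square)
  then show ?thesis using assms by simp
qed

lemma schr_power_limit:
  "(\<lambda>n. fps_nth (schroeder_fps ^ j) n / schr (Suc n)) \<longlonglongrightarrow> real j * (sqrt 2 - 1) ^ (j + 1)"
proof (induction j rule: induct_nat_012)
  case 0
  have "\<forall>\<^sub>F n in sequentially. fps_nth (schroeder_fps ^ 0) n / schr (Suc n) = 0"
    using eventually_ge_at_top[of 1] by eventually_elim auto
  then show ?case by (simp add: tendsto_eventually)
next
  case 1
  have "(sqrt 2 - 1) ^ 2 = 3 - 2 * sqrt 2" by (simp add: power2_eq_square algebra_simps)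
  then show ?case using schr_ratio_limit by (simp add: numeral_2_eq_2)
next
  case (ge2 j)
  let ?S = schroeder_fps and ?l = "sqrt 2 - 1"
  let ?A = "\<lambda>j n. fps_nth (?S ^ j) n / schr (Suc n)"
  have l2: "3 - 2 * sqrt 2 = ?l\<^sup>2" by (simp add: power2_eq_square algebra_simps)
  have "?S ^ Suc (Suc j) = ?S\<^sup>2 * ?S ^ j" by (simp add: power2_eq_square mult.assoc)
  also have "?S\<^sup>2 = ?S - fps_X * ?S - fps_X" using schroeder_fps_equation by (simp add: algebra_simps)
  finally have eq: "?S ^ Suc (Suc j) = ?S ^ Suc j - fps_X * (?S ^ Suc j + ?S ^ j)"
    by (simp add: algebra_simps)
  \<comment> \<open>Multiplication by x lowers the index by one, so those terms are renormalised by
    the ratio of consecutive Schroeder numbers, whose limit is l^2. For this the statement is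
    shifted to \<open>Suc n\<close>.\<close>
  have "?A (Suc (Suc j)) (Suc n) =
      ?A (Suc j) (Suc n) - (?A (Suc j) n + ?A j n) * (schr (Suc n) / schr (Suc (Suc n)))" for n
    unfolding eq using schr_pos[of "Suc n"] schr_pos[of "Suc (Suc n)"]
    by (simp del: power_Suc add: field_simps)
  moreover have "(\<lambda>n. ?A (Suc j) (Suc n) - (?A (Suc j) n + ?A j n) * (schr (Suc n) / schr (Suc (Suc n))))
      \<longlonglongrightarrow> real (Suc j) * ?l ^ (Suc j + 1) - (real (Suc j) * ?l ^ (Suc j + 1) + real j * ?l ^ (j + 1)) * ?l\<^sup>2"
    using LIMSEQ_Suc[OF ge2(2)] LIMSEQ_Suc[OF schr_ratio_limit] ge2 unfolding l2[symmetric]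
    by (intro tendsto_intros)
  moreover have "?l\<^sup>2 = 1 - 2 * ?l" by (simp add: power2_eq_square algebra_simps)
  note double_root_recurrence[OF this, of j]
  ultimately have "(\<lambda>n. ?A (Suc (Suc j)) (Suc n)) \<longlonglongrightarrow> real (Suc (Suc j)) * ?l ^ (Suc (Suc j) + 1)"
    by (simp only:)
  then show ?case by (rule LIMSEQ_imp_Suc)
qed

lemma degree_prob_limit:
  assumes "1 \<le> v" "1 \<le> k"
  shows "(\<lambda>n. degree_prob n v k) \<longlonglongrightarrow> 2 * (real k - 1) * (sqrt 2 - 1) ^ k"
proof -
  \<comment> \<open>Degree k means k - 2 chords and hence k - 1 pieces. The condition on
    \<open>v\<close> makes it a vertex, which holds for large \<open>r\<close>.\<close>
  have eq: "degree_prob (r + 2) v k = 2 * (fps_nth (schroeder_fps ^ (k - 1)) r / schr (Suc r))"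
    if "1 \<le> r" "v \<le> r" for r
  proof -
    have "degree_prob (r + 2) v k =
        card {D \<in> dissections (r + 2). 2 + card {a. (a, r + 1) \<in> D} = k} / card (dissections (r + 2))"
      using degree_prob_dissections[of "r + 2" v k] that assms by simp
    also have "real (card {D \<in> dissections (r + 2). 2 + card {a. (a, r + 1) \<in> D} = k}) =
        fps_nth (schroeder_fps ^ (k - 1)) r"
    \<comment> \<open>Degree 1 does not occur; this agrees with the vanishing coefficient of the
      zeroth power, since \<open>r\<close> is positive.\<close>
    proof (cases "k = 1")
      case True
      then show ?thesis using that by simp
    next
      case False
      then have k: "k - 1 = Suc (k - 2)" "2 \<le> k" using assms by auto
      then have "{D \<in> dissections (r + 2). 2 + card {a. (a, r + 1) \<in> D} = k} =
        {D \<in> dissections (r + 2). card {a. (a, r + 1) \<in> D} = k - 2}" by auto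
      then show ?thesis
        unfolding k(1) using card_dissections_by_degree[OF that(1)] schroeder_cut_fps[OF that(1)] by simp
    qed
    also have "real (card (dissections (r + 2))) = schr (Suc r) / 2"
      using schroeder_Suc_dissections[OF that(1)] by (simp add: schroeder_fps_def)
    finally show ?thesis by simp
  qed
  have "\<forall>\<^sub>F r in sequentially.
      2 * (fps_nth (schroeder_fps ^ (k - 1)) r / schr (Suc r)) = degree_prob (r + 2) v k"
    using eventually_ge_at_top[of "max 1 v"] by eventually_elim (rule eq[symmetric], auto)
  moreover have "(\<lambda>r. 2 * (fps_nth (schroeder_fps ^ (k - 1)) r / schr (Suc r)))
      \<longlonglongrightarrow> 2 * (real (k - 1) * (sqrt 2 - 1) ^ (k - 1 + 1))"
    by (intro tendsto_intros schr_power_limit)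
  ultimately have "(\<lambda>r. degree_prob (r + 2) v k) \<longlonglongrightarrow> 2 * (real (k - 1) * (sqrt 2 - 1) ^ (k - 1 + 1))"
    by (rule Lim_transform_eventually[rotated])
  then have "(\<lambda>n. degree_prob n v k) \<longlonglongrightarrow> 2 * (real (k - 1) * (sqrt 2 - 1) ^ (k - 1 + 1))"
    by (rule LIMSEQ_offset)
  moreover have "2 * (real (k - 1) * (sqrt 2 - 1) ^ (k - 1 + 1)) = 2 * (real k - 1) * (sqrt 2 - 1) ^ k"
    using assms(2) by (simp add: of_nat_diff)
  ultimately show ?thesis by (simp only:)
qed

section \<open>The limit law and its generating function\<close>

lemma limit_degree_prob_eq: "1 \<le> k \<Longrightarrow> limit_degree_prob k = 2 * (real k - 1) * (sqrt 2 - 1) ^ k"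
  unfolding limit_degree_prob_def by (intro limI degree_prob_limit) auto

text \<open>The differentiated geometric series, with its index shifted by 2; absolute convergence
  turns the ordered sum into an unordered one.\<close>

lemma has_sum_linear_geometric:
  fixes z :: "'a :: {real_normed_field, banach}"
  assumes "norm z < 1"
  shows "((\<lambda>k. (of_nat k - 1) * z ^ k) has_sum z\<^sup>2 / (1 - z)\<^sup>2) {2..}"
proof -
  have "norm (norm z) < 1" using assms by simp
  then have "summable (\<lambda>n. norm (of_nat (Suc n) * z ^ n))"
    using sums_summable[OF geometric_deriv_sums[of "norm z"]]
    by (simp add: norm_mult norm_power del: of_nat_Suc)
  moreover have "(\<lambda>n. of_nat (Suc n) * z ^ n) sums (1 / (1 - z)\<^sup>2)"
    by (rule geometric_deriv_sums[OF assms])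
  ultimately have "((\<lambda>n. of_nat (Suc n) * z ^ n) has_sum (1 / (1 - z)\<^sup>2)) UNIV"
    by (rule norm_summable_imp_has_sum)
  then have "((\<lambda>n. z\<^sup>2 * (of_nat (Suc n) * z ^ n)) has_sum (z\<^sup>2 * (1 / (1 - z)\<^sup>2))) UNIV"
    by (rule has_sum_cmult_right)
  moreover have "bij_betw (\<lambda>n. n + 2) UNIV {2::nat..}"
    by (rule bij_betw_byWitness[where f' = "\<lambda>n. n - 2"]) auto
  from has_sum_reindex_bij_betw[OF this, of "\<lambda>k. (of_nat k - 1) * z ^ k"]
  have "((\<lambda>k. (of_nat k - 1) * z ^ k) has_sum S) {2..} \<longleftrightarrow>
      ((\<lambda>n. z\<^sup>2 * (of_nat (Suc n) * z ^ n)) has_sum S) UNIV" for S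
    by (simp add: algebra_simps power2_eq_square)
  ultimately show ?thesis by simp
qed

theorem theorem3p2:
  shows "(\<forall>v k :: nat. v \<ge> 1 \<and> k \<ge> 1 \<longrightarrow>
            (\<lambda>n. degree_prob n v k) \<longlonglongrightarrow> limit_degree_prob k) \<and>
         limit_degree_fps =
           fps_const (2 * (3 - 2 * sqrt 2)) * fps_X ^ 2 / (1 - fps_const (sqrt 2 - 1) * fps_X) ^ 2 \<and>
         limit_degree_fps =
           Abs_fps (\<lambda>k. if k \<ge> 2 then 2 * (real k - 1) * (sqrt 2 - 1) ^ k else 0) \<and>
         (\<forall>w :: complex. norm w < sqrt 2 + 1 \<longrightarrow>
            ((\<lambda>k. of_real (limit_degree_prob k) * w ^ k) has_sum limit_degree_pgf w) {1..} \<and>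
            limit_degree_pgf w =
              2 * (3 - 2 * of_real (sqrt 2)) * w ^ 2 / (1 - of_real (sqrt 2 - 1) * w) ^ 2 \<and>
            ((\<lambda>k. 2 * (of_nat k - 1) * of_real (sqrt 2 - 1) ^ k * w ^ k)
               has_sum limit_degree_pgf w) {2..}) \<and>
         limit_degree_pgf 1 = 1 \<and>
         (\<forall>k\<ge>1. limit_degree_prob k \<ge> 0) \<and>
         (limit_degree_prob has_sum 1) {1..}"
proof -
  define l where "l = sqrt 2 - 1"
  have l: "0 < l" "l < 1" "l\<^sup>2 = 3 - 2 * sqrt 2" "(sqrt 2 + 1) * l = 1"
    using real_sqrt_less_mono[of 2 4] by (auto simp: l_def power2_eq_square algebra_simps)
  have lim: "limit_degree_prob k = 2 * (real k - 1) * l ^ k" if "1 \<le> k" for k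
    using limit_degree_prob_eq[OF that] by (simp add: l_def)
  have fps: "limit_degree_fps = Abs_fps (\<lambda>k. if k \<ge> 2 then 2 * (real k - 1) * l ^ k else 0)"
  proof (rule fps_ext)
    fix k :: nat
    consider "k = 0" | "k = 1" | "2 \<le> k" by linarith
    then show "fps_nth limit_degree_fps k =
        fps_nth (Abs_fps (\<lambda>k. if k \<ge> 2 then 2 * (real k - 1) * l ^ k else 0)) k"
      by cases (auto simp: limit_degree_fps_def lim)
  qed
  have fps': "limit_degree_fps = fps_const (2 * l\<^sup>2) * fps_X ^ 2 / (1 - fps_const l * fps_X) ^ 2"
  proof -
    let ?D = "(1 - fps_const l * fps_X)\<^sup>2 :: real fps"
    have D0: "fps_nth ?D 0 \<noteq> 0" by (simp add: fps_nth_power_0)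
    have "limit_degree_fps * ?D = fps_const (2 * l\<^sup>2) * fps_X ^ 2"
    proof (rule fps_ext)
      fix k
      have D: "limit_degree_fps * ?D = limit_degree_fps - fps_const (2 * l) * (fps_X * limit_degree_fps) +
          fps_const (l\<^sup>2) * (fps_X * (fps_X * limit_degree_fps))"
        by (simp add: power2_eq_square algebra_simps flip: fps_const_mult fps_const_add)
      show "fps_nth (limit_degree_fps * ?D) k = fps_nth (fps_const (2 * l\<^sup>2) * fps_X ^ 2) k"
      \<comment> \<open>From 4 on, all of \<open>k\<close>, \<open>k - 1\<close>,
        \<open>k - 2\<close> are in the range where the coefficients follow the formula; the smaller
        cases are checked one by one.\<close>
      proof (cases "k < 4")
        case True
        then have "k = 0 \<or> k = 1 \<or> k = 2 \<or> k = 3" by auto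
        then show ?thesis
          unfolding D by (auto simp: fps fps_X_power_nth power2_eq_square numeral_eq_Suc algebra_simps)
      next
        case False
        then obtain m where "k = m + 4" using le_Suc_ex[of 4 k] by (auto simp: add.commute)
        then show ?thesis
          unfolding D by (simp add: fps fps_X_power_nth numeral_eq_Suc algebra_simps)
      qed
    qed
    moreover have "?D \<noteq> 0" using D0 by auto
    ultimately show ?thesis
      by (metis nonzero_mult_div_cancel_right)
  qed
  \<comment> \<open>The term for \<open>k = 1\<close> vanishes, so the sum may start at 2.\<close>
  have sum1: "((\<lambda>k. of_real (limit_degree_prob k) * w ^ k) has_sum S) {1..} \<longleftrightarrow>
      ((\<lambda>k. 2 * (of_nat k - 1) * of_real l ^ k * w ^ k) has_sum S) {2..}" for w S :: complex
  proof (rule has_sum_cong_neutral)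
    fix k :: nat assume "k \<in> {1..} - {2..}"
    then have "k = 1" by auto
    then show "of_real (limit_degree_prob k) * w ^ k = 0" by (simp add: lim)
  next
    fix k :: nat assume "k \<in> {1..} \<inter> {2..}"
    then show "of_real (limit_degree_prob k) * w ^ k = 2 * (of_nat k - 1) * of_real l ^ k * w ^ k"
      by (simp add: lim)
  qed auto
  have sum2: "((\<lambda>k. 2 * (of_nat k - 1) * of_real l ^ k * w ^ k) has_sum
      2 * of_real (l\<^sup>2) * w\<^sup>2 / (1 - of_real l * w)\<^sup>2) {2..}" if "norm w < sqrt 2 + 1" for w :: complex
  proof -
    have "norm (of_real l * w) = norm w * l" using l(1) by (simp add: norm_mult)
    \<comment> \<open>The radius of convergence is 1 / l = sqrt 2 + 1.\<close>
    also have "\<dots> < (sqrt 2 + 1) * l" using that l(1) by (intro mult_strict_right_mono)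
    finally have "norm (of_real l * w) < 1" using l(4) by simp
    note has_sum_cmult_right[OF has_sum_linear_geometric[OF this], of 2]
    moreover have "(\<lambda>k. 2 * ((of_nat k - 1) * (of_real l * w) ^ k)) =
        (\<lambda>k. 2 * (of_nat k - 1) * of_real l ^ k * w ^ k)"
      by (simp add: fun_eq_iff power_mult_distrib)
    moreover have "2 * ((of_real l * w)\<^sup>2 / (1 - of_real l * w)\<^sup>2) =
        2 * of_real (l\<^sup>2) * w\<^sup>2 / (1 - of_real l * w)\<^sup>2"
      by (simp add: power_mult_distrib)
    ultimately show ?thesis by (simp only:)
  qed
  have pgf: "limit_degree_pgf w = 2 * of_real (l\<^sup>2) * w\<^sup>2 / (1 - of_real l * w)\<^sup>2"
    if "norm w < sqrt 2 + 1" for w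
    unfolding limit_degree_pgf_def using sum1 sum2[OF that] by (intro infsumI) blast
  have one: "limit_degree_pgf 1 = 1"
  proof -
    \<comment> \<open>The identity behind total mass 1: 1 - l = 2 - sqrt 2 equals sqrt 2 times
      l.\<close>
    have "2 * l\<^sup>2 = (1 - l)\<^sup>2" "1 - l \<noteq> 0" using l by (auto simp: l_def power2_eq_square algebra_simps)
    then have "2 * l\<^sup>2 / (1 - l)\<^sup>2 = 1" by simp
    then have "complex_of_real (2 * l\<^sup>2 / (1 - l)\<^sup>2) = 1" by (simp only: of_real_1)
    then show ?thesis using pgf[of 1] by simp
  qed
  have "((\<lambda>k. complex_of_real (limit_degree_prob k)) has_sum of_real 1) {1..}"
    using sum1[of 1 1] sum2[of 1] one pgf[of 1] by simp
  then have "(limit_degree_prob has_sum 1) {1..}"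
    using has_sum_of_real_iff by blast
  moreover have "0 \<le> limit_degree_prob k" if "1 \<le> k" for k using that l(1) by (simp add: lim)
  moreover have "(\<lambda>n. degree_prob n v k) \<longlonglongrightarrow> limit_degree_prob k" if "1 \<le> v" "1 \<le> k" for v k
    using degree_prob_limit[OF that] by (simp add: limit_degree_prob_eq[OF that(2)])
  moreover have "complex_of_real (l\<^sup>2) = 3 - 2 * of_real (sqrt 2)" by (simp add: l(3))
  ultimately show ?thesis
    using fps fps' sum1 sum2 pgf one unfolding l(3) l_def[symmetric] by auto
qed

end
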